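(* For any control strategy $\mathbf g\in\mathcal G$ of the team, the conditional probability density $p^{\mathbf g}(X_t\mid\Delta_t,\Lambda_t^{1:K})$ does not depend on the control strategy $\mathbf g$. It is an information state $\Pi_t(\Delta_t,\Lambda_t^{1:K})(X_t)$ for the team, i.e., $\Pi_t(\Delta_t,\Lambda_t^{1:K})(X_t)=p(X_t\mid\Delta_t,\Lambda_t^{1:K})$ with $\int_{\mathcal X_t}\Pi_t(\Delta_t,\Lambda_t^{1:K})(X_t)\,dX_t=1$, that can be evaluated from $\Delta_t,\Lambda_t^{1:K}$. Moreover, there is a function $\theta_t$, which does not depend on the control strategy $\mathbf g$, such that $$\Pi_{t+1}(\Delta_{t+1},\Lambda_{t+1}^{1:K})(X_{t+1})=\theta_t\big[\Pi_t(\Delta_t,\Lambda_t^{1:K})(X_t),\,Y_{t+1}^{1:K},\,U_t^{1:K}\big]$$ for all $t=0,1,\ldots,T-1$. (Here the information state is the entire density function, so $\theta_t$ takes the whole density $\Pi_t(\Delta_t,\Lambda_t^{1:K})(\cdot)$ as argument and returns a density on $\mathcal X_{t+1}$.)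
   Context: Model. $K,T\in\mathbb N$, $\mathcal K=\{1,\dots,K\}$; all random variables are defined on a probability space $(\Omega,\mathscr F,\mathbb P)$. The state $X_t$ takes values in a measurable space $(\mathcal X_t,\mathscr X_t)$, $t=0,\dots,T$; the decision $U_t^k$ of member $k\in\mathcal K$ takes values in a measurable space $(\mathcal U_t^k,\mathscr U_t^k)$ with $\mathcal U_t^k\neq\emptyset$, $t=0,\dots,T-1$. The state evolves by $X_{t+1}=f_t(X_t,U_t^{1:K},W_t)$, and member $k$ observes $Y_t^k=h_t^k(X_t,Z_t^k)$ with values in $(\mathcal Y^k,\mathscr Y^k)$. $\{W_t\}$ (values in $(\mathcal W,\mathscr W)$) is a sequence of independent random variables, independent of $X_0$; $\{Z_t^k\}_{t,k}$ (values in $(\mathcal Z^k,\mathscr Z^k)$) are independent random variables, independent of $X_0$ and of $\{W_t\}$. Notation. $A^{1:K}=(A^1,\dots,A^K)$ and $A_{s:t}=(A_s,\dots,A_t)$ (negative time indices are omitted). Information structure ($n$-step delayed sharing, $n\ge 1$ an integer). $\Delta_t=(Y_{0:t-n}^{1:K},U_{0:t-n}^{1:K})$ is known to all members; $\Lambda_t^k=(Y_{t-n+1:t}^k,U_{t-n+1:t-1}^k)$ is known only to member $k$. These take values in measurable spaces $(\mathcal D_t,\mathscr D_t)$ and $(\mathcal L_t^k,\mathscr L_t^k)$. Strategies. $\mathcal G$ is the set of centralized strategies $\mathbf g=\{g_t\}_{t=0}^{T-1}$, where $g_t$ is a measurable map from $\mathcal L_t^1\times\dots\times\mathcal L_t^K\times\mathcal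 D_t$ to $\prod_{k}\mathcal U_t^k$ and $U_t^{1:K}=g_t(\Lambda_t^{1:K},\Delta_t)$. Densities. All probability distributions are assumed to have (conditional) densities $p$. A superscript $\mathbf g$ (as in $p^{\mathbf g}$, $\mathbb E^{\mathbf g}$) indicates that the quantity is computed under strategy $\mathbf g$; absence of the superscript indicates that the quantity does not depend on the choice of $\mathbf g$. Definition. An information state $\Pi_t$ for the team is a quantity such that (a) $\Pi_t$ is a function of $(\Delta_t,\Lambda_t^{1:K})$, and (b) $\Pi_{t+1}$ can be determined from $\Pi_t$, $Y_{t+1}^{1:K}$ and $U_t^{1:K}$. *)

theory Defs
  imports "HOL-Probability.Probability"
begin

text \<open>
  Spaces that vary with time or with the member are families of measures on one common carrier
  type. Only the measurable space underlying \<open>dec_sp\<close>, \<open>noise_sp\<close>, \<open>obs_noise_sp\<close> matters, whereas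
  \<open>state_sp\<close> and \<open>obs_sp\<close> also carry the reference measures (the ``$dx$'') with respect to which
  densities are taken. A tuple indexed by the members is a function on \<open>{1..K}\<close>, extensional as in
  \<^const>\<open>PiM\<close>.
\<close>

record ('p, 'x, 'u, 'y, 'w, 'z) team =
  prob_sp :: "'p measure"
  num_mem :: nat
  horizon :: nat
  delay :: nat
  state_sp :: "nat \<Rightarrow> 'x measure"
  dec_sp :: "nat \<Rightarrow> nat \<Rightarrow> 'u measure"
  obs_sp :: "nat \<Rightarrow> 'y measure"
  noise_sp :: "'w measure"
  obs_noise_sp :: "nat \<Rightarrow> 'z measure"
  dyn :: "nat \<Rightarrow> 'x \<times> (nat \<Rightarrow> 'u) \<times> 'w \<Rightarrow> 'x"
  sens :: "nat \<Rightarrow> nat \<Rightarrow> 'x \<times> 'z \<Rightarrow> 'y"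
  init_rv :: "'p \<Rightarrow> 'x"
  noise_rv :: "nat \<Rightarrow> 'p \<Rightarrow> 'w"
  obs_noise_rv :: "nat \<Rightarrow> nat \<Rightarrow> 'p \<Rightarrow> 'z"

abbreviation members :: "('p, 'x, 'u, 'y, 'w, 'z, 'e) team_scheme \<Rightarrow> nat set" where
  "members m \<equiv> {1..num_mem m}"

definition joint_dec_sp :: "('p, 'x, 'u, 'y, 'w, 'z, 'e) team_scheme \<Rightarrow> nat \<Rightarrow> (nat \<Rightarrow> 'u) measure" where
  "joint_dec_sp m t = PiM (members m) (dec_sp m t)"

definition joint_obs_sp :: "('p, 'x, 'u, 'y, 'w, 'z, 'e) team_scheme \<Rightarrow> (nat \<Rightarrow> 'y) measure" where
  "joint_obs_sp m = PiM (members m) (obs_sp m)"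

text \<open>
  The index set \<open>{s. s + n \<le> t}\<close> is $0,\dots,t-n$ and \<open>{s. t < s + n \<and> s \<le> t}\<close> is
  $t-n+1,\dots,t$, both with negative indices omitted.
\<close>

type_synonym ('y, 'u) shared_info = "(nat \<Rightarrow> nat \<Rightarrow> 'y) \<times> (nat \<Rightarrow> nat \<Rightarrow> 'u)"
type_synonym ('y, 'u) private_info = "(nat \<Rightarrow> 'y) \<times> (nat \<Rightarrow> 'u)"

definition shared_sp ::
  "('p, 'x, 'u, 'y, 'w, 'z, 'e) team_scheme \<Rightarrow> nat \<Rightarrow> ('y, 'u) shared_info measure" where
  "shared_sp m t =
     PiM {s. s + delay m \<le> t} (\<lambda>_. joint_obs_sp m) \<Otimes>\<^sub>M PiM {s. s + delay m \<le> t} (joint_dec_sp m)"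

definition private_sp ::
  "('p, 'x, 'u, 'y, 'w, 'z, 'e) team_scheme \<Rightarrow> nat \<Rightarrow> nat \<Rightarrow> ('y, 'u) private_info measure" where
  "private_sp m t k =
     PiM {s. t < s + delay m \<and> s \<le> t} (\<lambda>_. obs_sp m k) \<Otimes>\<^sub>M
     PiM {s. t < s + delay m \<and> s < t} (\<lambda>s. dec_sp m s k)"

definition joint_private_sp ::
  "('p, 'x, 'u, 'y, 'w, 'z, 'e) team_scheme \<Rightarrow> nat \<Rightarrow> (nat \<Rightarrow> ('y, 'u) private_info) measure" where
  "joint_private_sp m t = PiM (members m) (private_sp m t)"

text \<open>\<open>Y t \<omega>\<close> and \<open>U t \<omega>\<close> are the tuples $Y_t^{1:K}$ and $U_t^{1:K}$.\<close>

definition shared_data ::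
  "('p, 'x, 'u, 'y, 'w, 'z, 'e) team_scheme \<Rightarrow> nat \<Rightarrow> (nat \<Rightarrow> 'p \<Rightarrow> nat \<Rightarrow> 'y) \<Rightarrow>
     (nat \<Rightarrow> 'p \<Rightarrow> nat \<Rightarrow> 'u) \<Rightarrow> 'p \<Rightarrow> ('y, 'u) shared_info" where
  "shared_data m t Y U \<omega> =
     (\<lambda>s\<in>{s. s + delay m \<le> t}. Y s \<omega>, \<lambda>s\<in>{s. s + delay m \<le> t}. U s \<omega>)"

definition private_data ::
  "('p, 'x, 'u, 'y, 'w, 'z, 'e) team_scheme \<Rightarrow> nat \<Rightarrow> (nat \<Rightarrow> 'p \<Rightarrow> nat \<Rightarrow> 'y) \<Rightarrow>
     (nat \<Rightarrow> 'p \<Rightarrow> nat \<Rightarrow> 'u) \<Rightarrow> 'p \<Rightarrow> nat \<Rightarrow> ('y, 'u) private_info" where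
  "private_data m t Y U \<omega> = (\<lambda>k\<in>members m.
     (\<lambda>s\<in>{s. t < s + delay m \<and> s \<le> t}. Y s \<omega> k, \<lambda>s\<in>{s. t < s + delay m \<and> s < t}. U s \<omega> k))"

definition strategies ::
  "('p, 'x, 'u, 'y, 'w, 'z, 'e) team_scheme \<Rightarrow>
     (nat \<Rightarrow> (nat \<Rightarrow> ('y, 'u) private_info) \<times> ('y, 'u) shared_info \<Rightarrow> nat \<Rightarrow> 'u) set" where
  "strategies m =
     {g. \<forall>t < horizon m. g t \<in> joint_private_sp m t \<Otimes>\<^sub>M shared_sp m t \<rightarrow>\<^sub>M joint_dec_sp m t}"

text \<open>
  The processes generated by a strategy. For \<open>delay m \<ge> 1\<close> the equations determine \<open>X\<close>, \<open>Y\<close> up to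
  time \<open>T\<close> and \<open>U\<close> up to time \<open>T - 1\<close>, since the data used at time \<open>t\<close> only involve decisions
  taken before \<open>t\<close>.
\<close>

definition closed_loop ::
  "('p, 'x, 'u, 'y, 'w, 'z, 'e) team_scheme \<Rightarrow>
     (nat \<Rightarrow> (nat \<Rightarrow> ('y, 'u) private_info) \<times> ('y, 'u) shared_info \<Rightarrow> nat \<Rightarrow> 'u) \<Rightarrow>
     (nat \<Rightarrow> 'p \<Rightarrow> 'x) \<Rightarrow> (nat \<Rightarrow> 'p \<Rightarrow> nat \<Rightarrow> 'y) \<Rightarrow> (nat \<Rightarrow> 'p \<Rightarrow> nat \<Rightarrow> 'u) \<Rightarrow> bool" where
  "closed_loop m g X Y U \<longleftrightarrow> (\<forall>\<omega> \<in> space (prob_sp m).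
     X 0 \<omega> = init_rv m \<omega> \<and>
     (\<forall>t < horizon m. X (Suc t) \<omega> = dyn m t (X t \<omega>, U t \<omega>, noise_rv m t \<omega>)) \<and>
     (\<forall>t \<le> horizon m. Y t \<omega> = (\<lambda>k\<in>members m. sens m t k (X t \<omega>, obs_noise_rv m t k \<omega>))) \<and>
     (\<forall>t < horizon m. U t \<omega> = g t (private_data m t Y U \<omega>, shared_data m t Y U \<omega>)))"

lemma closed_loop_exists:
  assumes "1 \<le> delay m"
  shows "\<exists>X Y U. closed_loop m g X Y U"
proof -
  define obs where "obs t \<omega> x = (\<lambda>k\<in>members m. sens m t k (x, obs_noise_rv m t k \<omega>))" for t \<omega> x
  define ctl where "ctl t Y U = g t (private_data m t Y U undefined, shared_data m t Y U undefined)"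
    for t Y U
  define step where "step \<omega> t = (\<lambda>(x, Y, U). let u = ctl t Y U; x' = dyn m t (x, u, noise_rv m t \<omega>)
      in (x', Y(Suc t := (\<lambda>_. obs (Suc t) \<omega> x')), U(t := (\<lambda>_. u))))" for \<omega> t
  define run where "run \<omega> = rec_nat (init_rv m \<omega>, \<lambda>_ _. obs 0 \<omega> (init_rv m \<omega>), \<lambda>_ _. undefined) (step \<omega>)"
    for \<omega>
  define X where "X t \<omega> = fst (run \<omega> t)" for t \<omega>
  define YY where "YY t \<omega> = fst (snd (run \<omega> t))" for t \<omega>
  define UU where "UU t \<omega> = snd (snd (run \<omega> t))" for t \<omega>
  define Y where "Y t \<omega> = YY t \<omega> t undefined" for t \<omega>
  define U where "U t \<omega> = UU (Suc t) \<omega> t undefined" for t \<omega>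
  have rs: "run \<omega> (Suc t) = step \<omega> t (X t \<omega>, YY t \<omega>, UU t \<omega>)" for \<omega> t
    by (simp add: run_def X_def YY_def UU_def)
  have X: "X (Suc t) \<omega> = dyn m t (X t \<omega>, ctl t (YY t \<omega>) (UU t \<omega>), noise_rv m t \<omega>)"
    and YS: "YY (Suc t) \<omega> = (YY t \<omega>)(Suc t := (\<lambda>_. obs (Suc t) \<omega> (X (Suc t) \<omega>)))"
    and US: "UU (Suc t) \<omega> = (UU t \<omega>)(t := (\<lambda>_. ctl t (YY t \<omega>) (UU t \<omega>)))" for t \<omega>
    unfolding X_def[of "Suc t"] YY_def[of "Suc t"] UU_def[of "Suc t"] rs
    by (simp_all add: step_def Let_def)
  have Yk: "s \<le> t \<Longrightarrow> YY t \<omega> s undefined = Y s \<omega>" for s t \<omega>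
    by (induction t) (auto simp: Y_def YS le_Suc_eq)
  have Uk: "s < t \<Longrightarrow> UU t \<omega> s undefined = U s \<omega>" for s t \<omega>
    by (induction t) (auto simp: U_def US less_Suc_eq)
  have ctl: "ctl t (YY t \<omega>) (UU t \<omega>) = g t (private_data m t Y U \<omega>, shared_data m t Y U \<omega>)" for t \<omega>
  proof -
    have "private_data m t (YY t \<omega>) (UU t \<omega>) undefined = private_data m t Y U \<omega>"
      unfolding private_data_def by (auto simp: fun_eq_iff restrict_def Yk Uk)
    moreover have "shared_data m t (YY t \<omega>) (UU t \<omega>) undefined = shared_data m t Y U \<omega>"
      unfolding shared_data_def using assms by (auto simp: fun_eq_iff restrict_def Yk Uk)
    ultimately show ?thesis
      by (simp add: ctl_def)
  qed
  have U: "U t \<omega> = ctl t (YY t \<omega>) (UU t \<omega>)" for t \<omega>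
    by (simp add: U_def US)
  have X0: "X 0 \<omega> = init_rv m \<omega>" for \<omega>
    by (simp add: X_def run_def)
  have Y: "Y t \<omega> = obs t \<omega> (X t \<omega>)" for t \<omega>
    by (cases t) (simp_all add: Y_def YS, simp add: YY_def X_def run_def)
  have "closed_loop m g X Y U"
    unfolding closed_loop_def by (auto simp: X0 X U[symmetric] Y obs_def) (simp add: U ctl)
  then show ?thesis by blast
qed

definition prob_density :: "'a measure \<Rightarrow> ('a \<Rightarrow> ennreal) \<Rightarrow> bool" where
  "prob_density N \<pi> \<longleftrightarrow> \<pi> \<in> borel_measurable N \<and> (\<integral>\<^sup>+ x. \<pi> x \<partial>N) = 1"

text \<open>
  For random variables \<open>F a\<close> on \<open>M\<close> depending on a parameter \<open>a\<close>: each \<open>F a\<close> has a density with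
  respect to \<open>N\<close>, and these densities can be chosen jointly measurable in parameter and argument.
\<close>

definition has_density_kernel ::
  "'p measure \<Rightarrow> 'a measure \<Rightarrow> 'b measure \<Rightarrow> ('a \<Rightarrow> 'p \<Rightarrow> 'b) \<Rightarrow> bool" where
  "has_density_kernel M R N F \<longleftrightarrow>
     (\<exists>p :: 'a \<Rightarrow> 'b \<Rightarrow> ennreal. (\<lambda>(a, b). p a b) \<in> borel_measurable (R \<Otimes>\<^sub>M N) \<and>
        (\<forall>a \<in> space R. distributed M N (F a) (p a)))"

text \<open>
  \<open>p\<close> is a version of the conditional density of \<open>V\<close> given \<open>H\<close>: for every measurable \<open>A\<close>, the
  conditional probability of $V \in A$ given the $\sigma$-algebra generated by \<open>H\<close> is the integral
  of \<open>p (H \<omega>)\<close> over \<open>A\<close>.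
\<close>

definition cond_density ::
  "'p measure \<Rightarrow> 'a measure \<Rightarrow> 'b measure \<Rightarrow> ('p \<Rightarrow> 'a) \<Rightarrow> ('p \<Rightarrow> 'b) \<Rightarrow> ('a \<Rightarrow> 'b \<Rightarrow> ennreal) \<Rightarrow> bool"
  where
  "cond_density M R N H V p \<longleftrightarrow>
     H \<in> M \<rightarrow>\<^sub>M R \<and> V \<in> M \<rightarrow>\<^sub>M N \<and>
     (\<lambda>(a, b). p a b) \<in> borel_measurable (R \<Otimes>\<^sub>M N) \<and>
     (\<forall>A \<in> sets N. AE \<omega> in M.
        nn_cond_exp M (vimage_algebra (space M) H R) (indicator (V -` A \<inter> space M)) \<omega> =
        (\<integral>\<^sup>+ x \<in> A. p (H \<omega>) x \<partial>N))"

text \<open>\<^const>\<open>prob_space.indep_var\<close> requires both variables to have the same type.\<close>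

definition indep_pair ::
  "'p measure \<Rightarrow> 'a measure \<Rightarrow> ('p \<Rightarrow> 'a) \<Rightarrow> 'b measure \<Rightarrow> ('p \<Rightarrow> 'b) \<Rightarrow> bool" where
  "indep_pair M N V N' V' \<longleftrightarrow> V \<in> M \<rightarrow>\<^sub>M N \<and> V' \<in> M \<rightarrow>\<^sub>M N' \<and>
     prob_space.indep_set M {V -` A \<inter> space M | A. A \<in> sets N} {V' -` B \<inter> space M | B. B \<in> sets N'}"

text \<open>
  The three density assumptions are the existence of $p(x_0)$, $p(x_{t+1} \mid x_t, u_t^{1:K})$ and
  $p(y_t^k \mid x_t)$.
\<close>

definition team_model :: "('p, 'x, 'u, 'y, 'w, 'z, 'e) team_scheme \<Rightarrow> bool" where
  "team_model m \<longleftrightarrow>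
     (let M = prob_sp m; K = members m; T = horizon m;
          W = (\<lambda>\<omega>. \<lambda>t\<in>{..<T}. noise_rv m t \<omega>);
          Wsp = PiM {..<T} (\<lambda>_. noise_sp m);
          Z = (\<lambda>\<omega>. \<lambda>(t, k)\<in>{..T} \<times> K. obs_noise_rv m t k \<omega>);
          Zsp = PiM ({..T} \<times> K) (\<lambda>(t, k). obs_noise_sp m k)
      in prob_space M \<and> 1 \<le> delay m \<and>
         (\<forall>t \<le> T. sigma_finite_measure (state_sp m t)) \<and>
         (\<forall>k \<in> K. sigma_finite_measure (obs_sp m k)) \<and>
         (\<forall>t < T. \<forall>k \<in> K. space (dec_sp m t k) \<noteq> {}) \<and>
         (\<forall>t < T. dyn m t \<in> state_sp m t \<Otimes>\<^sub>M joint_dec_sp m t \<Otimes>\<^sub>M noise_sp m \<rightarrow>\<^sub>M state_sp m (Suc t)) \<and>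
         (\<forall>t \<le> T. \<forall>k \<in> K. sens m t k \<in> state_sp m t \<Otimes>\<^sub>M obs_noise_sp m k \<rightarrow>\<^sub>M obs_sp m k) \<and>
         prob_space.indep_vars M (\<lambda>_. noise_sp m) (noise_rv m) {..<T} \<and>
         indep_pair M (state_sp m 0) (init_rv m) Wsp W \<and>
         prob_space.indep_vars M (\<lambda>(t, k). obs_noise_sp m k) (\<lambda>(t, k). obs_noise_rv m t k) ({..T} \<times> K) \<and>
         indep_pair M (state_sp m 0 \<Otimes>\<^sub>M Wsp) (\<lambda>\<omega>. (init_rv m \<omega>, W \<omega>)) Zsp Z \<and>
         (\<exists>p. distributed M (state_sp m 0) (init_rv m) p) \<and>
         (\<forall>t < T. has_density_kernel M (state_sp m t \<Otimes>\<^sub>M joint_dec_sp m t) (state_sp m (Suc t))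
            (\<lambda>(x, u) \<omega>. dyn m t (x, u, noise_rv m t \<omega>))) \<and>
         (\<forall>t \<le> T. \<forall>k \<in> K. has_density_kernel M (state_sp m t) (obs_sp m k)
            (\<lambda>x \<omega>. sens m t k (x, obs_noise_rv m t k \<omega>))))"

text \<open>Dependence on $(\Delta_t, \Lambda_t^{1:K})$ only is expressed by the type of \<open>S\<close>.\<close>

definition information_state ::
  "('p, 'x, 'u, 'y, 'w, 'z, 'e) team_scheme \<Rightarrow>
     (nat \<Rightarrow> ('y, 'u) shared_info \<times> (nat \<Rightarrow> ('y, 'u) private_info) \<Rightarrow> 'i) \<Rightarrow> bool" where
  "information_state m S \<longleftrightarrow>
     (\<exists>\<phi>. \<forall>g \<in> strategies m. \<forall>X Y U. closed_loop m g X Y U \<longrightarrow>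
        (\<forall>t < horizon m. \<forall>\<omega> \<in> space (prob_sp m).
           S (Suc t) (shared_data m (Suc t) Y U \<omega>, private_data m (Suc t) Y U \<omega>) =
           \<phi> t (S t (shared_data m t Y U \<omega>, private_data m t Y U \<omega>)) (Y (Suc t) \<omega>) (U t \<omega>)))"

end

theory Submission
  imports Defs
begin

text \<open>
  The posterior of the state is the Bayes filter run along the full history
  $(Y_{0:t}^{1:K}, U_{0:t-1}^{1:K})$, which is exactly what $(\Delta_t, \Lambda_t^{1:K})$ records. One
  step predicts with $p(x_{t+1} \mid x_t, u_t^{1:K})$ and then reweights with
  $\prod_k p(y_{t+1}^k \mid x_{t+1})$. Since the decision is a function of the history, the strategy
  enters neither the prediction density nor the likelihood; it only selects the histories that
  occur. That the filter computes the conditional density follows by induction on time, because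
  $W_t$ is independent of everything up to time \<open>t\<close>, and $Z_{t+1}^{1:K}$ is independent of
  $X_{t+1}$ and everything up to time \<open>t\<close>.
\<close>

subsection \<open>Conditional densities\<close>

text \<open>The recursion is demanded at every sample point, whereas conditional densities are
  determined only almost surely. No null set may therefore be discarded: versions of the three model
  densities are fixed once, before any strategy, and the filter is made a total map that yields a
  probability density for every history, including those of probability zero. Almost sure arguments
  are confined to showing that this map computes a conditional density. A second obstacle is that
  independence is given only piecewise, between variables of different types. It is assembled into
  one independent family of event classes, indexed by the primitive random variables; independence
  from a closed-loop variable is then read off from the primitive variables of which it is a
  function. The delay being at least 1 ensures that the data used for a decision do not contain that
  decision.\<close>

text \<open>Implies \<^const>\<open>cond_density\<close> for \<open>\<sigma>\<close>-finite \<open>N\<close>, but integrates every nonnegative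
  function of the pair, so that prediction and Bayes' rule become applications of Fubini's theorem.\<close>

definition cond_kernel ::
  "'p measure \<Rightarrow> 'a measure \<Rightarrow> 'b measure \<Rightarrow> ('p \<Rightarrow> 'a) \<Rightarrow> ('p \<Rightarrow> 'b) \<Rightarrow> ('a \<Rightarrow> 'b \<Rightarrow> ennreal) \<Rightarrow> bool"
  where
  "cond_kernel M R N H V p \<longleftrightarrow>
     H \<in> M \<rightarrow>\<^sub>M R \<and> V \<in> M \<rightarrow>\<^sub>M N \<and> (\<lambda>(a, b). p a b) \<in> borel_measurable (R \<Otimes>\<^sub>M N) \<and>
     (\<forall>F \<in> borel_measurable (R \<Otimes>\<^sub>M N).
        (\<integral>\<^sup>+ \<omega>. F (H \<omega>, V \<omega>) \<partial>M) = (\<integral>\<^sup>+ \<omega>. (\<integral>\<^sup>+ x. F (H \<omega>, x) * p (H \<omega>) x \<partial>N) \<partial>M))"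

lemma cond_kernelD:
  assumes "cond_kernel M R N H V p"
  shows cond_kernel_cond: "H \<in> M \<rightarrow>\<^sub>M R"
    and cond_kernel_var: "V \<in> M \<rightarrow>\<^sub>M N"
    and cond_kernel_measurable: "(\<lambda>(a, b). p a b) \<in> borel_measurable (R \<Otimes>\<^sub>M N)"
    and cond_kernel_nn_integral: "F \<in> borel_measurable (R \<Otimes>\<^sub>M N) \<Longrightarrow>
      (\<integral>\<^sup>+ \<omega>. F (H \<omega>, V \<omega>) \<partial>M) = (\<integral>\<^sup>+ \<omega>. (\<integral>\<^sup>+ x. F (H \<omega>, x) * p (H \<omega>) x \<partial>N) \<partial>M)"
  using assms by (auto simp: cond_kernel_def)

text \<open>Sets generated by \<open>H\<close> are preimages of some \<open>B\<close>, so the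
  products of an indicator of \<open>B\<close> and one of \<open>A\<close> are test functions enough
  for the averaging identity that characterises conditional expectation. The candidate depends on
  the sample point through \<open>H\<close> only, which makes it measurable for the generated
  algebra.\<close>

lemma cond_kernel_imp_cond_density:
  assumes "prob_space M" "sigma_finite_measure N" and ck: "cond_kernel M R N H V p"
  shows "cond_density M R N H V p"
proof -
  interpret prob_space M by fact
  interpret N: sigma_finite_measure N by fact
  note [measurable] = cond_kernelD(1-3)[OF ck]
  let ?G = "vimage_algebra (space M) H R"
  have HS: "H \<in> space M \<rightarrow> space R"
    using measurable_space[OF cond_kernel_cond[OF ck]] by auto
  have sub: "subalgebra M ?G"
    unfolding subalgebra_def sets_vimage_algebra2[OF HS] using cond_kernel_cond[OF ck] by auto
  interpret G: finite_measure_subalgebra M ?G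
    using sub by unfold_locales
  have HG: "H \<in> ?G \<rightarrow>\<^sub>M R"
    using HS by (rule measurable_vimage_algebra1)
  have "AE \<omega> in M. nn_cond_exp M ?G (indicator (V -` A \<inter> space M)) \<omega> = (\<integral>\<^sup>+ x \<in> A. p (H \<omega>) x \<partial>N)"
    if A[measurable]: "A \<in> sets N" for A
  proof -
    have m: "(\<lambda>h. \<integral>\<^sup>+ x \<in> A. p h x \<partial>N) \<in> borel_measurable R"
      by measurable
    have "AE \<omega> in M. (\<integral>\<^sup>+ x \<in> A. p (H \<omega>) x \<partial>N) = nn_cond_exp M ?G (indicator (V -` A \<inter> space M)) \<omega>"
    proof (rule G.nn_cond_exp_charact)
      fix C assume "C \<in> sets ?G"
      then obtain B where B[measurable]: "B \<in> sets R" and C: "C = H -` B \<inter> space M"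
        by (auto simp: sets_vimage_algebra2[OF HS])
      have "(\<integral>\<^sup>+ \<omega> \<in> C. indicator (V -` A \<inter> space M) \<omega> \<partial>M) =
          (\<integral>\<^sup>+ \<omega>. (\<lambda>(h, x). indicator B h * indicator A x) (H \<omega>, V \<omega>) \<partial>M)"
        by (intro nn_integral_cong) (auto simp: C split: split_indicator)
      also have "\<dots> = (\<integral>\<^sup>+ \<omega>. (\<integral>\<^sup>+ x. (\<lambda>(h, x). indicator B h * indicator A x) (H \<omega>, x) * p (H \<omega>) x \<partial>N) \<partial>M)"
        by (intro cond_kernel_nn_integral[OF ck]) measurable
      also have "\<dots> = (\<integral>\<^sup>+ \<omega> \<in> C. (\<integral>\<^sup>+ x \<in> A. p (H \<omega>) x \<partial>N) \<partial>M)"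
        by (intro nn_integral_cong)
          (auto simp: C mult.commute intro!: nn_integral_cong split: split_indicator)
      finally show "(\<integral>\<^sup>+ \<omega> \<in> C. indicator (V -` A \<inter> space M) \<omega> \<partial>M) =
          (\<integral>\<^sup>+ \<omega> \<in> C. (\<integral>\<^sup>+ x \<in> A. p (H \<omega>) x \<partial>N) \<partial>M)" .
    next
      show "(\<lambda>\<omega>. \<integral>\<^sup>+ x \<in> A. p (H \<omega>) x \<partial>N) \<in> borel_measurable ?G"
        using measurable_compose[OF HG m] .
    qed measurable
    then show ?thesis by (auto elim: eventually_mono)
  qed
  then show ?thesis
    using cond_kernelD(1-3)[OF ck] by (simp add: cond_density_def)
qed

text \<open>Test functions of the new data pull back along \<open>J\<close>, and the density
  survives because it factors through \<open>J\<close>. This serves both to pass from histories to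
  the data of the team and to append to a history entries that are computable from it.\<close>

lemma cond_kernel_image:
  assumes ck: "cond_kernel M R N H V p" and J[measurable]: "J \<in> R \<rightarrow>\<^sub>M R'"
    and H': "\<And>\<omega>. \<omega> \<in> space M \<Longrightarrow> H' \<omega> = J (H \<omega>)" and V': "\<And>\<omega>. \<omega> \<in> space M \<Longrightarrow> V' \<omega> = V \<omega>"
    and p'[measurable]: "(\<lambda>(a, b). p' a b) \<in> borel_measurable (R' \<Otimes>\<^sub>M N)"
    and p: "\<And>h. h \<in> space R \<Longrightarrow> p' (J h) = p h"
  shows "cond_kernel M R' N H' V' p'"
proof -
  note [measurable] = cond_kernelD(1-3)[OF ck]
  have "H' \<in> M \<rightarrow>\<^sub>M R' \<longleftrightarrow> (\<lambda>\<omega>. J (H \<omega>)) \<in> M \<rightarrow>\<^sub>M R'" "V' \<in> M \<rightarrow>\<^sub>M N \<longleftrightarrow> V \<in> M \<rightarrow>\<^sub>M N"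
    by (intro measurable_cong; simp add: H' V')+
  moreover have "(\<integral>\<^sup>+ \<omega>. F (H' \<omega>, V' \<omega>) \<partial>M) = (\<integral>\<^sup>+ \<omega>. (\<integral>\<^sup>+ x. F (H' \<omega>, x) * p' (H' \<omega>) x \<partial>N) \<partial>M)"
    if [measurable]: "F \<in> borel_measurable (R' \<Otimes>\<^sub>M N)" for F
  proof -
    have "(\<integral>\<^sup>+ \<omega>. F (H' \<omega>, V' \<omega>) \<partial>M) = (\<integral>\<^sup>+ \<omega>. (\<lambda>(h, x). F (J h, x)) (H \<omega>, V \<omega>) \<partial>M)"
      by (intro nn_integral_cong) (simp add: H' V')
    also have "\<dots> = (\<integral>\<^sup>+ \<omega>. (\<integral>\<^sup>+ x. (\<lambda>(h, x). F (J h, x)) (H \<omega>, x) * p (H \<omega>) x \<partial>N) \<partial>M)"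
      by (intro cond_kernel_nn_integral[OF ck]) measurable
    also have "\<dots> = (\<integral>\<^sup>+ \<omega>. (\<integral>\<^sup>+ x. F (H' \<omega>, x) * p' (H' \<omega>) x \<partial>N) \<partial>M)"
      using measurable_space[OF cond_kernel_cond[OF ck]] by (intro nn_integral_cong) (simp add: H' p)
    finally show ?thesis .
  qed
  ultimately show ?thesis
    by (simp add: cond_kernel_def)
qed

section \<open>Independent pairs and the conditional densities they generate\<close>

lemma (in prob_space) prob_indep_pair:
  assumes "indep_pair M N V N' V'" "A \<in> sets N" "B \<in> sets N'"
  shows "prob ((V -` A \<inter> space M) \<inter> (V' -` B \<inter> space M)) = prob (V -` A \<inter> space M) * prob (V' -` B \<inter> space M)"
  by (rule indep_setD[OF conjunct2[OF conjunct2[OF assms(1)[unfolded indep_pair_def]]]])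
    (use assms(2,3) in blast)+

lemma (in prob_space) distr_indep_pair:
  assumes "indep_pair M N V N' V'"
  shows "distr M (N \<Otimes>\<^sub>M N') (\<lambda>\<omega>. (V \<omega>, V' \<omega>)) = distr M N V \<Otimes>\<^sub>M distr M N' V'"
proof -
  have [measurable]: "V \<in> M \<rightarrow>\<^sub>M N" "V' \<in> M \<rightarrow>\<^sub>M N'"
    using assms by (auto simp: indep_pair_def)
  show ?thesis
  proof (rule pair_measure_eqI[symmetric])
    show "sigma_finite_measure (distr M N V)" "sigma_finite_measure (distr M N' V')"
      by (intro prob_space_imp_sigma_finite prob_space_distr; measurable)+
  next
    fix A B assume "A \<in> sets (distr M N V)" "B \<in> sets (distr M N' V')"
    then have [measurable]: "A \<in> sets N" "B \<in> sets N'" by auto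
    have "emeasure (distr M (N \<Otimes>\<^sub>M N') (\<lambda>\<omega>. (V \<omega>, V' \<omega>))) (A \<times> B) =
        prob ((V -` A \<inter> space M) \<inter> (V' -` B \<inter> space M))"
      by (subst emeasure_distr) (auto simp: emeasure_eq_measure intro!: arg_cong[where f=prob])
    also have "\<dots> = ennreal (prob (V -` A \<inter> space M) * prob (V' -` B \<inter> space M))"
      by (simp add: prob_indep_pair[OF assms])
    finally show "emeasure (distr M N V) A * emeasure (distr M N' V') B =
        emeasure (distr M (N \<Otimes>\<^sub>M N') (\<lambda>\<omega>. (V \<omega>, V' \<omega>))) (A \<times> B)"
      by (simp add: emeasure_distr emeasure_eq_measure ennreal_mult)
  qed simp
qed

text \<open>Freezing: the law of the pair is a product, so \<open>V\<close> can be held at a value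
  \<open>v\<close> while \<open>W\<close> is integrated, and then only the law of
  \<open>f (v, W)\<close> matters. State transition and observation are both of this form.\<close>

lemma (in prob_space) cond_kernel_indep:
  assumes ind: "indep_pair M R V S W" and N: "sigma_finite_measure N"
    and f[measurable]: "f \<in> R \<Otimes>\<^sub>M S \<rightarrow>\<^sub>M N"
    and p[measurable]: "(\<lambda>(a, b). p a b) \<in> borel_measurable (R \<Otimes>\<^sub>M N)"
    and d: "\<And>v. v \<in> space R \<Longrightarrow> distributed M N (\<lambda>\<omega>. f (v, W \<omega>)) (p v)"
    and V': "\<And>\<omega>. \<omega> \<in> space M \<Longrightarrow> V' \<omega> = f (V \<omega>, W \<omega>)"
  shows "cond_kernel M R N V V' p"
proof -
  interpret N: sigma_finite_measure N by fact
  have [measurable]: "V \<in> M \<rightarrow>\<^sub>M R" "W \<in> M \<rightarrow>\<^sub>M S"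
    using ind by (auto simp: indep_pair_def)
  interpret W: prob_space "distr M S W" by (rule prob_space_distr) measurable
  have "V' \<in> M \<rightarrow>\<^sub>M N \<longleftrightarrow> (\<lambda>\<omega>. f (V \<omega>, W \<omega>)) \<in> M \<rightarrow>\<^sub>M N"
    by (intro measurable_cong) (simp add: V')
  then have "V' \<in> M \<rightarrow>\<^sub>M N" by simp
  moreover have "(\<integral>\<^sup>+ \<omega>. F (V \<omega>, V' \<omega>) \<partial>M) = (\<integral>\<^sup>+ \<omega>. (\<integral>\<^sup>+ x. F (V \<omega>, x) * p (V \<omega>) x \<partial>N) \<partial>M)"
    if [measurable]: "F \<in> borel_measurable (R \<Otimes>\<^sub>M N)" for F
  proof -
    have inner: "(\<integral>\<^sup>+ w. F (v, f (v, w)) \<partial>distr M S W) = (\<integral>\<^sup>+ x. F (v, x) * p v x \<partial>N)"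
      if [measurable]: "v \<in> space R" for v
    proof -
      have "(\<integral>\<^sup>+ w. F (v, f (v, w)) \<partial>distr M S W) = (\<integral>\<^sup>+ \<omega>. F (v, f (v, W \<omega>)) \<partial>M)"
        by (subst nn_integral_distr) measurable
      also have "\<dots> = (\<integral>\<^sup>+ x. p v x * F (v, x) \<partial>N)"
        by (rule distributed_nn_integral[OF d, symmetric]) measurable
      finally show ?thesis by (simp add: mult.commute)
    qed
    have "(\<integral>\<^sup>+ \<omega>. F (V \<omega>, V' \<omega>) \<partial>M) = (\<integral>\<^sup>+ \<omega>. (\<lambda>(v, w). F (v, f (v, w))) (V \<omega>, W \<omega>) \<partial>M)"
      by (intro nn_integral_cong) (simp add: V')
    also have "\<dots> = (\<integral>\<^sup>+ z. (\<lambda>(v, w). F (v, f (v, w))) z \<partial>distr M (R \<Otimes>\<^sub>M S) (\<lambda>\<omega>. (V \<omega>, W \<omega>)))"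
      by (subst nn_integral_distr) measurable
    also have "\<dots> = (\<integral>\<^sup>+ v. (\<integral>\<^sup>+ w. F (v, f (v, w)) \<partial>distr M S W) \<partial>distr M R V)"
      unfolding distr_indep_pair[OF ind] by (subst W.nn_integral_fst[symmetric]) auto
    also have "\<dots> = (\<integral>\<^sup>+ v. (\<integral>\<^sup>+ x. F (v, x) * p v x \<partial>N) \<partial>distr M R V)"
      by (intro nn_integral_cong inner) simp
    also have "\<dots> = (\<integral>\<^sup>+ \<omega>. (\<integral>\<^sup>+ x. F (V \<omega>, x) * p (V \<omega>) x \<partial>N) \<partial>M)"
      by (subst nn_integral_distr) measurable
    finally show ?thesis .
  qed
  ultimately show ?thesis
    by (simp add: cond_kernel_def)
qed

text \<open>The Chapman-Kolmogorov equation: condition twice, then move the old state inside by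
  Tonelli's theorem. The kernel \<open>q\<close> may depend on \<open>h\<close>, which is where the
  decision will enter.\<close>

lemma cond_kernel_predict:
  assumes "sigma_finite_measure N" "sigma_finite_measure N'"
    and ck: "cond_kernel M R N H V p" and ck': "cond_kernel M (R \<Otimes>\<^sub>M N) N' (\<lambda>\<omega>. (H \<omega>, V \<omega>)) V' q"
  shows "cond_kernel M R N' H V' (\<lambda>h x'. \<integral>\<^sup>+ x. p h x * q (h, x) x' \<partial>N)"
proof -
  interpret N: sigma_finite_measure N by fact
  interpret N': sigma_finite_measure N' by fact
  interpret P: pair_sigma_finite N N' ..
  note [measurable] = cond_kernelD(1-3)[OF ck] cond_kernelD(2,3)[OF ck']
  have "(\<integral>\<^sup>+ \<omega>. F (H \<omega>, V' \<omega>) \<partial>M) =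
      (\<integral>\<^sup>+ \<omega>. (\<integral>\<^sup>+ x'. F (H \<omega>, x') * (\<integral>\<^sup>+ x. p (H \<omega>) x * q (H \<omega>, x) x' \<partial>N) \<partial>N') \<partial>M)"
    if [measurable]: "F \<in> borel_measurable (R \<Otimes>\<^sub>M N')" for F
  proof -
    have "(\<integral>\<^sup>+ \<omega>. F (H \<omega>, V' \<omega>) \<partial>M) = (\<integral>\<^sup>+ \<omega>. (\<lambda>z. F (fst (fst z), snd z)) ((H \<omega>, V \<omega>), V' \<omega>) \<partial>M)"
      by simp
    also have "\<dots> = (\<integral>\<^sup>+ \<omega>. (\<lambda>(h, x). \<integral>\<^sup>+ x'. F (h, x') * q (h, x) x' \<partial>N') (H \<omega>, V \<omega>) \<partial>M)"
      by (subst cond_kernel_nn_integral[OF ck']) measurable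
    also have "\<dots> = (\<integral>\<^sup>+ \<omega>. (\<integral>\<^sup>+ x. (\<integral>\<^sup>+ x'. F (H \<omega>, x') * q (H \<omega>, x) x' \<partial>N') * p (H \<omega>) x \<partial>N) \<partial>M)"
      by (subst cond_kernel_nn_integral[OF ck]) measurable
    also have "\<dots> = (\<integral>\<^sup>+ \<omega>. (\<integral>\<^sup>+ x'. F (H \<omega>, x') * (\<integral>\<^sup>+ x. p (H \<omega>) x * q (H \<omega>, x) x' \<partial>N) \<partial>N') \<partial>M)"
    proof (rule nn_integral_cong)
      fix \<omega> assume "\<omega> \<in> space M"
      then have [measurable]: "H \<omega> \<in> space R"
        by (rule measurable_space[OF cond_kernel_cond[OF ck]])
      have "(\<integral>\<^sup>+ x. (\<integral>\<^sup>+ x'. F (H \<omega>, x') * q (H \<omega>, x) x' \<partial>N') * p (H \<omega>) x \<partial>N) =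
          (\<integral>\<^sup>+ x. (\<integral>\<^sup>+ x'. F (H \<omega>, x') * (p (H \<omega>) x * q (H \<omega>, x) x') \<partial>N') \<partial>N)"
        by (intro nn_integral_cong, subst nn_integral_multc[symmetric])
          (auto intro!: nn_integral_cong simp: ac_simps)
      also have "\<dots> = (\<integral>\<^sup>+ x'. (\<integral>\<^sup>+ x. F (H \<omega>, x') * (p (H \<omega>) x * q (H \<omega>, x) x') \<partial>N) \<partial>N')"
        by (intro P.Fubini'[symmetric]) measurable
      also have "\<dots> = (\<integral>\<^sup>+ x'. F (H \<omega>, x') * (\<integral>\<^sup>+ x. p (H \<omega>) x * q (H \<omega>, x) x' \<partial>N) \<partial>N')"
        by (intro nn_integral_cong nn_integral_cmult) measurable
      finally show "(\<integral>\<^sup>+ x. (\<integral>\<^sup>+ x'. F (H \<omega>, x') * q (H \<omega>, x) x' \<partial>N') * p (H \<omega>) x \<partial>N) = \<dots>" .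
    qed
    finally show ?thesis .
  qed
  then show ?thesis
    by (simp add: cond_kernel_def)
qed

text \<open>The prior is kept where the evidence is \<open>0\<close> or \<open>\<infinity>\<close>, so that the result is always a
  probability density; this happens with probability \<open>0\<close> only.\<close>

definition bayes :: "'x measure \<Rightarrow> ('x \<Rightarrow> ennreal) \<Rightarrow> ('x \<Rightarrow> ennreal) \<Rightarrow> 'x \<Rightarrow> ennreal" where
  "bayes N L p x = (let c = \<integral>\<^sup>+ x. L x * p x \<partial>N in if c = 0 \<or> c = \<infinity> then p x else L x * p x / c)"

text \<open>Either the prior is returned unchanged, or the reweighted function is divided by its own
  finite nonzero mass.\<close>

lemma prob_density_bayes:
  assumes p: "prob_density N p" and [measurable]: "L \<in> borel_measurable N"
  shows "prob_density N (bayes N L p)"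
proof -
  have [measurable]: "p \<in> borel_measurable N" using p by (simp add: prob_density_def)
  define c where "c = (\<integral>\<^sup>+ x. L x * p x \<partial>N)"
  have b: "bayes N L p = (\<lambda>x. if c = 0 \<or> c = \<infinity> then p x else L x * p x / c)"
    by (simp add: bayes_def c_def fun_eq_iff)
  show ?thesis
  proof (cases "c = 0 \<or> c = \<infinity>")
    case True
    then have "bayes N L p = p" by (auto simp: b fun_eq_iff)
    then show ?thesis using p by simp
  next
    case False
    have "(\<integral>\<^sup>+ x. L x * p x / c \<partial>N) = c / c"
      unfolding c_def by (rule nn_integral_divide) measurable
    also have "\<dots> = 1" using False by (intro ennreal_divide_self) (auto simp: top.not_eq_extremum)
    finally show ?thesis using False by (simp add: prob_density_def b)
  qed
qed

lemma measurable_bayes: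
  assumes "sigma_finite_measure N"
    and [measurable]: "(\<lambda>(h, x). L h x) \<in> borel_measurable (R \<Otimes>\<^sub>M N)"
      "(\<lambda>(h, x). p h x) \<in> borel_measurable (R \<Otimes>\<^sub>M N)"
  shows "(\<lambda>(h, x). bayes N (L h) (p h) x) \<in> borel_measurable (R \<Otimes>\<^sub>M N)"
proof -
  interpret sigma_finite_measure N by fact
  show ?thesis unfolding bayes_def Let_def by measurable
qed

text \<open>Given \<open>H = h\<close>, the pair \<open>(Y, V)\<close> has density
  \<open>L y x * p h x\<close>, with \<open>c h y\<close> as its marginal in \<open>y\<close>.
  Multiplying the Bayes quotient by \<open>c\<close> gives this density back wherever
  \<open>c\<close> is finite, and infinite evidence turns out to be negligible.\<close>

lemma cond_kernel_bayes:
  assumes "prob_space M" "sigma_finite_measure N" "sigma_finite_measure S"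
    and ck: "cond_kernel M R N H V p" and ck': "cond_kernel M (R \<Otimes>\<^sub>M N) S (\<lambda>\<omega>. (H \<omega>, V \<omega>)) Y (\<lambda>(h, x) y. L y x)"
    and L[measurable]: "(\<lambda>(y, x). L y x) \<in> borel_measurable (S \<Otimes>\<^sub>M N)"
  shows "cond_kernel M (R \<Otimes>\<^sub>M S) N (\<lambda>\<omega>. (H \<omega>, Y \<omega>)) V (\<lambda>(h, y). bayes N (L y) (p h))"
proof -
  interpret prob_space M by fact
  interpret N: sigma_finite_measure N by fact
  interpret S: sigma_finite_measure S by fact
  interpret P: pair_sigma_finite N S ..
  note [measurable] = cond_kernelD(1-3)[OF ck] cond_kernelD(2)[OF ck']
  define c where "c h y = (\<integral>\<^sup>+ x. L y x * p h x \<partial>N)" for h y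
  define b where "b z = (case z of (h, y) \<Rightarrow> bayes N (L y) (p h))" for z
  have b: "b (h, y) x = (if c h y = 0 \<or> c h y = \<infinity> then p h x else L y x * p h x / c h y)" for h y x
    by (simp add: b_def c_def bayes_def)
  have [measurable]: "(\<lambda>(h, y). c h y) \<in> borel_measurable (R \<Otimes>\<^sub>M S)"
    unfolding c_def by measurable
  have [measurable]: "(\<lambda>(z, x). b z x) \<in> borel_measurable ((R \<Otimes>\<^sub>M S) \<Otimes>\<^sub>M N)"
    unfolding b_def case_prod_beta
    by (rule measurable_bayes[unfolded case_prod_beta]) (use assms(2) in measurable)
  have joint: "(\<integral>\<^sup>+ \<omega>. F ((H \<omega>, Y \<omega>), V \<omega>) \<partial>M) =
      (\<integral>\<^sup>+ \<omega>. (\<integral>\<^sup>+ y. (\<integral>\<^sup>+ x. F ((H \<omega>, y), x) * (L y x * p (H \<omega>) x) \<partial>N) \<partial>S) \<partial>M)"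
    if [measurable]: "F \<in> borel_measurable ((R \<Otimes>\<^sub>M S) \<Otimes>\<^sub>M N)" for F
  proof -
    have "(\<integral>\<^sup>+ \<omega>. F ((H \<omega>, Y \<omega>), V \<omega>) \<partial>M) = (\<integral>\<^sup>+ \<omega>. (\<lambda>z. F ((fst (fst z), snd z), snd (fst z))) ((H \<omega>, V \<omega>), Y \<omega>) \<partial>M)"
      by simp
    also have "\<dots> = (\<integral>\<^sup>+ \<omega>. (\<lambda>(h, x). \<integral>\<^sup>+ y. F ((h, y), x) * L y x \<partial>S) (H \<omega>, V \<omega>) \<partial>M)"
      by (subst cond_kernel_nn_integral[OF ck']) measurable
    also have "\<dots> = (\<integral>\<^sup>+ \<omega>. (\<integral>\<^sup>+ x. (\<integral>\<^sup>+ y. F ((H \<omega>, y), x) * L y x \<partial>S) * p (H \<omega>) x \<partial>N) \<partial>M)"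
      by (subst cond_kernel_nn_integral[OF ck]) measurable
    also have "\<dots> = (\<integral>\<^sup>+ \<omega>. (\<integral>\<^sup>+ y. (\<integral>\<^sup>+ x. F ((H \<omega>, y), x) * (L y x * p (H \<omega>) x) \<partial>N) \<partial>S) \<partial>M)"
    proof (rule nn_integral_cong)
      fix \<omega> assume "\<omega> \<in> space M"
      then have [measurable]: "H \<omega> \<in> space R"
        by (rule measurable_space[OF cond_kernel_cond[OF ck]])
      have "(\<integral>\<^sup>+ x. (\<integral>\<^sup>+ y. F ((H \<omega>, y), x) * L y x \<partial>S) * p (H \<omega>) x \<partial>N) =
          (\<integral>\<^sup>+ x. (\<integral>\<^sup>+ y. F ((H \<omega>, y), x) * (L y x * p (H \<omega>) x) \<partial>S) \<partial>N)"
        by (intro nn_integral_cong, subst nn_integral_multc[symmetric])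
          (auto intro!: nn_integral_cong simp: ac_simps)
      also have "\<dots> = (\<integral>\<^sup>+ y. (\<integral>\<^sup>+ x. F ((H \<omega>, y), x) * (L y x * p (H \<omega>) x) \<partial>N) \<partial>S)"
        by (intro P.Fubini'[symmetric]) measurable
      finally show "(\<integral>\<^sup>+ x. (\<integral>\<^sup>+ y. F ((H \<omega>, y), x) * L y x \<partial>S) * p (H \<omega>) x \<partial>N) = \<dots>" .
    qed
    finally show ?thesis .
  qed
  \<comment> \<open>Test functions that ignore \<open>V\<close> show that \<open>c\<close> is the
    conditional density of \<open>Y\<close> given \<open>H\<close>.\<close>
  have marginal: "(\<integral>\<^sup>+ \<omega>. G (H \<omega>, Y \<omega>) \<partial>M) = (\<integral>\<^sup>+ \<omega>. (\<integral>\<^sup>+ y. G (H \<omega>, y) * c (H \<omega>) y \<partial>S) \<partial>M)"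
    if [measurable]: "G \<in> borel_measurable (R \<Otimes>\<^sub>M S)" for G
  proof -
    have "(\<integral>\<^sup>+ \<omega>. G (H \<omega>, Y \<omega>) \<partial>M) =
        (\<integral>\<^sup>+ \<omega>. (\<integral>\<^sup>+ y. (\<integral>\<^sup>+ x. G (H \<omega>, y) * (L y x * p (H \<omega>) x) \<partial>N) \<partial>S) \<partial>M)"
      using joint[of "\<lambda>(z, x). G z"] by simp
    also have "\<dots> = (\<integral>\<^sup>+ \<omega>. (\<integral>\<^sup>+ y. G (H \<omega>, y) * c (H \<omega>) y \<partial>S) \<partial>M)"
    proof (intro nn_integral_cong)
      fix \<omega> y assume "\<omega> \<in> space M" and [measurable]: "y \<in> space S"
      then have [measurable]: "H \<omega> \<in> space R"
        by (intro measurable_space[OF cond_kernel_cond[OF ck]])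
      show "(\<integral>\<^sup>+ x. G (H \<omega>, y) * (L y x * p (H \<omega>) x) \<partial>N) = G (H \<omega>, y) * c (H \<omega>) y"
        unfolding c_def by (rule nn_integral_cmult) measurable
    qed
    finally show ?thesis .
  qed
  \<comment> \<open>The total integral of \<open>c\<close> is the total probability 1, so
    \<open>c\<close> is finite almost everywhere.\<close>
  have fin: "AE \<omega> in M. AE y in S. c (H \<omega>) y \<noteq> \<infinity>"
  proof -
    have one: "(\<integral>\<^sup>+ \<omega>. (\<integral>\<^sup>+ y. c (H \<omega>) y \<partial>S) \<partial>M) = 1"
      using marginal[of "\<lambda>_. 1"] by (simp add: emeasure_space_1)
    have "AE \<omega> in M. (\<integral>\<^sup>+ y. c (H \<omega>) y \<partial>S) \<noteq> \<infinity>"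
      by (rule nn_integral_PInf_AE) (simp_all add: one)
    then show ?thesis
    proof (rule AE_mp, intro AE_I2[where M=M] impI)
      fix \<omega> assume "\<omega> \<in> space M" and *: "(\<integral>\<^sup>+ y. c (H \<omega>) y \<partial>S) \<noteq> \<infinity>"
      then have [measurable]: "H \<omega> \<in> space R"
        by (intro measurable_space[OF cond_kernel_cond[OF ck]])
      show "AE y in S. c (H \<omega>) y \<noteq> \<infinity>"
        using * by (intro nn_integral_PInf_AE) measurable
    qed
  qed
  have cancel: "(\<integral>\<^sup>+ x. F ((h, y), x) * (L y x * p h x) \<partial>N) = (\<integral>\<^sup>+ x. F ((h, y), x) * b (h, y) x \<partial>N) * c h y"
    if [measurable]: "F \<in> borel_measurable ((R \<Otimes>\<^sub>M S) \<Otimes>\<^sub>M N)" "h \<in> space R" "y \<in> space S"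
      and "c h y \<noteq> \<infinity>" for F h y
  proof (cases "c h y = 0")
    \<comment> \<open>Zero evidence forces \<open>L y x * p h x\<close> to vanish for almost all
      \<open>x\<close>, while on the other side the fallback is multiplied by
      \<open>c h y = 0\<close>.\<close>
    case True
    then have "AE x in N. L y x * p h x = 0"
      unfolding c_def by (subst (asm) nn_integral_0_iff_AE) measurable
    then have "(\<integral>\<^sup>+ x. F ((h, y), x) * (L y x * p h x) \<partial>N) = (\<integral>\<^sup>+ x. 0 \<partial>N)"
      by (intro nn_integral_cong_AE) auto
    then show ?thesis using True by simp
  next
    case False
    have "(\<integral>\<^sup>+ x. F ((h, y), x) * b (h, y) x \<partial>N) * c h y = (\<integral>\<^sup>+ x. F ((h, y), x) * b (h, y) x * c h y \<partial>N)"
      by (rule nn_integral_multc[symmetric]) measurable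
    also have "\<dots> = (\<integral>\<^sup>+ x. F ((h, y), x) * (L y x * p h x) \<partial>N)"
    proof (rule nn_integral_cong)
      fix x
      have "c h y / c h y = 1"
        using False that(4) by (intro ennreal_divide_self) (auto simp: less_top)
      then show "F ((h, y), x) * b (h, y) x * c h y = F ((h, y), x) * (L y x * p h x)"
        using False that(4) by (simp add: b mult.assoc ennreal_divide_times)
    qed
    finally show ?thesis by simp
  qed
  have "(\<integral>\<^sup>+ \<omega>. F ((H \<omega>, Y \<omega>), V \<omega>) \<partial>M) = (\<integral>\<^sup>+ \<omega>. (\<integral>\<^sup>+ x. F ((H \<omega>, Y \<omega>), x) * b (H \<omega>, Y \<omega>) x \<partial>N) \<partial>M)"
    if F[measurable]: "F \<in> borel_measurable ((R \<Otimes>\<^sub>M S) \<Otimes>\<^sub>M N)" for F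
  proof -
    have "(\<integral>\<^sup>+ \<omega>. F ((H \<omega>, Y \<omega>), V \<omega>) \<partial>M) =
        (\<integral>\<^sup>+ \<omega>. (\<integral>\<^sup>+ y. (\<integral>\<^sup>+ x. F ((H \<omega>, y), x) * (L y x * p (H \<omega>) x) \<partial>N) \<partial>S) \<partial>M)"
      by (rule joint) fact
    also have "\<dots> = (\<integral>\<^sup>+ \<omega>. (\<integral>\<^sup>+ y. (\<integral>\<^sup>+ x. F ((H \<omega>, y), x) * b (H \<omega>, y) x \<partial>N) * c (H \<omega>) y \<partial>S) \<partial>M)"
    proof (rule nn_integral_cong_AE, rule AE_mp[OF fin], rule AE_I2, rule impI)
      fix \<omega> assume "\<omega> \<in> space M" and ae: "AE y in S. c (H \<omega>) y \<noteq> \<infinity>"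
      have h: "H \<omega> \<in> space R"
        using \<open>\<omega> \<in> space M\<close> by (rule measurable_space[OF cond_kernel_cond[OF ck]])
      have "AE y in S. (\<integral>\<^sup>+ x. F ((H \<omega>, y), x) * (L y x * p (H \<omega>) x) \<partial>N) =
          (\<integral>\<^sup>+ x. F ((H \<omega>, y), x) * b (H \<omega>, y) x \<partial>N) * c (H \<omega>) y"
        using ae AE_space by eventually_elim (rule cancel[OF F h])
      then show "(\<integral>\<^sup>+ y. (\<integral>\<^sup>+ x. F ((H \<omega>, y), x) * (L y x * p (H \<omega>) x) \<partial>N) \<partial>S) =
          (\<integral>\<^sup>+ y. (\<integral>\<^sup>+ x. F ((H \<omega>, y), x) * b (H \<omega>, y) x \<partial>N) * c (H \<omega>) y \<partial>S)"
        by (rule nn_integral_cong_AE)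
    qed
    \<comment> \<open>\<open>marginal\<close> read from right to left absorbs the factor
      \<open>c\<close> into the law of \<open>Y\<close>.\<close>
    also have "\<dots> = (\<integral>\<^sup>+ \<omega>. (\<integral>\<^sup>+ x. F ((H \<omega>, Y \<omega>), x) * b (H \<omega>, Y \<omega>) x \<partial>N) \<partial>M)"
      using marginal[of "\<lambda>(h, y). \<integral>\<^sup>+ x. F ((h, y), x) * b (h, y) x \<partial>N"] by simp
    finally show ?thesis .
  qed
  then show ?thesis
    unfolding b_def[symmetric, abs_def] cond_kernel_def by simp
qed

section \<open>Finite families: reindexing, product events and product densities\<close>

lemma (in prob_space) indep_sets_reindex:
  assumes "inj_on f I" and indep: "indep_sets F (f ` I)"
  shows "indep_sets (\<lambda>i. F (f i)) I"
proof (rule indep_setsI)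
  show "F (f i) \<subseteq> events" if "i \<in> I" for i
    using indep that by (auto simp: indep_sets_def)
next
  fix A J assume J: "J \<noteq> {}" "J \<subseteq> I" "finite J" "\<forall>j\<in>J. A j \<in> F (f j)"
  have inv: "the_inv_into I f (f j) = j" if "j \<in> J" for j
    using that J(2) the_inv_into_f_f[OF assms(1)] by auto
  have "prob (\<Inter>j\<in>f ` J. A (the_inv_into I f j)) = (\<Prod>j\<in>f ` J. prob (A (the_inv_into I f j)))"
    using J by (intro indep_setsD[OF indep]) (auto simp: inv)
  then show "prob (\<Inter>j\<in>J. A j) = (\<Prod>j\<in>J. prob (A j))"
    using inj_on_subset[OF assms(1) J(2)] by (simp add: prod.reindex inv cong: INF_cong_simp)
qed

text \<open>The empty family is a case of its own, with probability 1; it occurs when the horizon or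
  the number of members is 0.\<close>

lemma (in prob_space) prob_Int_indep_vars:
  assumes "indep_vars N V I" "finite I" "\<And>i. i \<in> I \<Longrightarrow> A i \<in> sets (N i)"
  shows "prob {\<omega> \<in> space M. \<forall>i\<in>I. V i \<omega> \<in> A i} = (\<Prod>i\<in>I. prob (V i -` A i \<inter> space M))"
proof (cases "I = {}")
  case True
  then show ?thesis by (simp add: prob_space)
next
  case False
  have "{\<omega> \<in> space M. \<forall>i\<in>I. V i \<omega> \<in> A i} = (\<Inter>i\<in>I. V i -` A i \<inter> space M)"
    using False by auto
  then show ?thesis
    using indep_varsD_finite[OF assms(1) False assms(2,3)] by simp
qed

text \<open>The locale of sigma-finite products asks for sigma-finiteness at all indices. Off
  \<open>I\<close> the factors are replaced by null measures, which leaves the product over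
  \<open>I\<close> unchanged.\<close>

lemma sigma_finite_measure_PiM:
  assumes "finite I" "\<And>i. i \<in> I \<Longrightarrow> sigma_finite_measure (N i)"
  shows "sigma_finite_measure (PiM I N)"
proof -
  define N' where "N' i = (if i \<in> I then N i else null_measure (N i))" for i
  have "sigma_finite_measure (null_measure (N i))" for i
    by (rule finite_measure.axioms(1)) (simp add: finite_measureI)
  then interpret product_sigma_finite N'
    by (intro product_sigma_finite.intro) (simp add: N'_def assms)
  have "PiM I N = PiM I N'" by (rule PiM_cong) (auto simp: N'_def)
  then show ?thesis using sigma_finite[OF \<open>finite I\<close>] by simp
qed

text \<open>The joint law and the measure with the product density are both identified with the
  product of the marginal laws \<open>D\<close>, by agreement on boxes. Factors off \<open>I\<close>
  are again padded by null measures.\<close>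

lemma (in prob_space) distributed_PiM:
  assumes "finite I" and indep: "indep_vars N V I"
    and sf: "\<And>i. i \<in> I \<Longrightarrow> sigma_finite_measure (N i)"
    and d: "\<And>i. i \<in> I \<Longrightarrow> distributed M (N i) (V i) (f i)"
  shows "distributed M (PiM I N) (\<lambda>\<omega>. \<lambda>i\<in>I. V i \<omega>) (\<lambda>x. \<Prod>i\<in>I. f i (x i))"
proof -
  define N' where "N' i = (if i \<in> I then N i else null_measure (N i))" for i
  define D where "D i = (if i \<in> I then distr M (N i) (V i) else null_measure (N i))" for i
  have nul: "sigma_finite_measure (null_measure (N i))" for i
    by (rule finite_measure.axioms(1)) (simp add: finite_measureI)
  interpret N': product_sigma_finite N'
    by (rule product_sigma_finite.intro) (simp add: N'_def sf nul)
  have rv[measurable]: "i \<in> I \<Longrightarrow> V i \<in> M \<rightarrow>\<^sub>M N i" and fm[measurable]: "i \<in> I \<Longrightarrow> f i \<in> borel_measurable (N i)" for i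
    using d by (auto simp: distributed_def)
  interpret D: product_sigma_finite D
    by (rule product_sigma_finite.intro) (simp add: D_def nul prob_space_imp_sigma_finite prob_space_distr)
  have NN: "PiM I N = PiM I N'" by (rule PiM_cong) (auto simp: N'_def)
  have sD: "sets (PiM I D) = sets (PiM I N)" by (rule sets_PiM_cong) (auto simp: D_def)
  have [measurable]: "(\<lambda>\<omega>. \<lambda>i\<in>I. V i \<omega>) \<in> M \<rightarrow>\<^sub>M PiM I N"
    by measurable
  have [measurable]: "(\<lambda>x. \<Prod>i\<in>I. f i (x i)) \<in> borel_measurable (PiM I N)"
    by measurable
  have "distr M (PiM I N) (\<lambda>\<omega>. \<lambda>i\<in>I. V i \<omega>) = PiM I D"
  proof (rule D.PiM_eqI)
    fix A assume "\<And>i. i \<in> I \<Longrightarrow> A i \<in> sets (D i)"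
    then have A[measurable]: "i \<in> I \<Longrightarrow> A i \<in> sets (N i)" for i by (simp add: D_def)
    have "emeasure (distr M (PiM I N) (\<lambda>\<omega>. \<lambda>i\<in>I. V i \<omega>)) (Pi\<^sub>E I A) =
        prob {\<omega> \<in> space M. \<forall>i\<in>I. V i \<omega> \<in> A i}"
      using \<open>finite I\<close> by (subst emeasure_distr)
        (auto simp: emeasure_eq_measure PiE_iff intro!: arg_cong[where f=prob] sets_PiM_I_finite)
    also have "\<dots> = (\<Prod>i\<in>I. emeasure (D i) (A i))"
      by (subst prob_Int_indep_vars[OF indep \<open>finite I\<close> A])
        (auto simp: D_def emeasure_distr emeasure_eq_measure prod_ennreal)
    finally show "emeasure (distr M (PiM I N) (\<lambda>\<omega>. \<lambda>i\<in>I. V i \<omega>)) (Pi\<^sub>E I A) = \<dots>" .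
  qed (use \<open>finite I\<close> sD in auto)
  moreover have "density (PiM I N) (\<lambda>x. \<Prod>i\<in>I. f i (x i)) = PiM I D"
  proof (rule D.PiM_eqI)
    fix A assume "\<And>i. i \<in> I \<Longrightarrow> A i \<in> sets (D i)"
    then have A[measurable]: "i \<in> I \<Longrightarrow> A i \<in> sets (N i)" for i by (simp add: D_def)
    have "emeasure (density (PiM I N) (\<lambda>x. \<Prod>i\<in>I. f i (x i))) (Pi\<^sub>E I A) =
        (\<integral>\<^sup>+ x. (\<Prod>i\<in>I. f i (x i)) * indicator (Pi\<^sub>E I A) x \<partial>PiM I N)"
      using \<open>finite I\<close> by (intro emeasure_density) (auto intro!: sets_PiM_I_finite)
    \<comment> \<open>On extensional functions the indicator of a box is the product of the
      coordinate indicators, so the integral can be split into one factor per index.\<close>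
    also have "\<dots> = (\<integral>\<^sup>+ x. (\<Prod>i\<in>I. f i (x i) * indicator (A i) (x i)) \<partial>PiM I N')"
      unfolding NN[symmetric]
      by (intro nn_integral_cong)
        (use \<open>finite I\<close> in \<open>auto simp: prod.distrib space_PiM PiE_iff indicator_def prod_zero_iff split: if_splits\<close>)
    also have "\<dots> = (\<Prod>i\<in>I. \<integral>\<^sup>+ x. f i x * indicator (A i) x \<partial>N' i)"
      by (rule N'.product_nn_integral_prod) (use \<open>finite I\<close> in \<open>auto simp: N'_def\<close>)
    also have "\<dots> = (\<Prod>i\<in>I. emeasure (D i) (A i))"
      using d by (intro prod.cong) (auto simp: D_def N'_def distributed_def emeasure_density)
    finally show "emeasure (density (PiM I N) (\<lambda>x. \<Prod>i\<in>I. f i (x i))) (Pi\<^sub>E I A) = \<dots>" .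
  qed (use \<open>finite I\<close> sD in auto)
  ultimately show ?thesis by (simp add: distributed_def)
qed

subsection \<open>The model\<close>

lemma Int_stable_vimage: "Int_stable {f -` A \<inter> S | A. A \<in> sets N}"
proof (rule Int_stableI, safe)
  fix A B assume "A \<in> sets N" "B \<in> sets N"
  then show "\<exists>C. f -` A \<inter> S \<inter> (f -` B \<inter> S) = f -` C \<inter> S \<and> C \<in> sets N"
    by (intro exI[of _ "A \<inter> B"]) auto
qed

lemma space_in_vimage: "f \<in> M \<rightarrow>\<^sub>M N \<Longrightarrow> space M \<in> {f -` A \<inter> space M | A. A \<in> sets N}"
  by (auto dest: measurable_space intro!: exI[of _ "space N"])

lemma vimage_restrict_PiE: "(\<lambda>\<omega>. restrict (V \<omega>) I) -` Pi\<^sub>E I A \<inter> S = {\<omega> \<in> S. \<forall>i\<in>I. V \<omega> i \<in> A i}"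
  by (auto simp: PiE_iff)

type_synonym ('y, 'u) history = "(nat \<Rightarrow> nat \<Rightarrow> 'y) \<times> (nat \<Rightarrow> nat \<Rightarrow> 'u)"

text \<open>Labels for the primitive random variables X_0, W_t and Z_t^k. As these take values in
  three different types, their joint independence is expressed through families of events with these
  labels as indices.\<close>

datatype source = Init | Dyn nat | Obs nat nat

text \<open>Versions of the densities are fixed here while no strategy is in scope, so whatever is
  built from \<open>p0\<close>, \<open>q\<close> and \<open>r\<close> is common to all
  strategies.\<close>

locale team_filter =
  fixes m :: "('p, 'x, 'u, 'y, 'w, 'z) team"
    and p0 :: "'x \<Rightarrow> ennreal"
    and q :: "nat \<Rightarrow> 'x \<times> (nat \<Rightarrow> 'u) \<Rightarrow> 'x \<Rightarrow> ennreal"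
    and r :: "nat \<Rightarrow> nat \<Rightarrow> 'x \<Rightarrow> 'y \<Rightarrow> ennreal"
  assumes model: "team_model m"
    and init: "distributed (prob_sp m) (state_sp m 0) (init_rv m) p0"
    and trans_measurable: "\<And>t. t < horizon m \<Longrightarrow>
      (\<lambda>(a, x). q t a x) \<in> borel_measurable ((state_sp m t \<Otimes>\<^sub>M joint_dec_sp m t) \<Otimes>\<^sub>M state_sp m (Suc t))"
    and trans: "\<And>t x u. \<lbrakk>t < horizon m; x \<in> space (state_sp m t); u \<in> space (joint_dec_sp m t)\<rbrakk> \<Longrightarrow>
      distributed (prob_sp m) (state_sp m (Suc t)) (\<lambda>\<omega>. dyn m t (x, u, noise_rv m t \<omega>)) (q t (x, u))"
    and sens_measurable: "\<And>t k. \<lbrakk>t \<le> horizon m; k \<in> members m\<rbrakk> \<Longrightarrow>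
      (\<lambda>(x, y). r t k x y) \<in> borel_measurable (state_sp m t \<Otimes>\<^sub>M obs_sp m k)"
    and sens: "\<And>t k x. \<lbrakk>t \<le> horizon m; k \<in> members m; x \<in> space (state_sp m t)\<rbrakk> \<Longrightarrow>
      distributed (prob_sp m) (obs_sp m k) (\<lambda>\<omega>. sens m t k (x, obs_noise_rv m t k \<omega>)) (r t k x)"
begin

abbreviation M where "M \<equiv> prob_sp m"
abbreviation T where "T \<equiv> horizon m"
abbreviation K where "K \<equiv> members m"
abbreviation Nx where "Nx \<equiv> state_sp m"
abbreviation Ny where "Ny \<equiv> joint_obs_sp m"
abbreviation Nu where "Nu \<equiv> joint_dec_sp m"

lemma prob_space_M: "prob_space M"
  and delay_ge_1: "1 \<le> delay m"
  and sigma_finite_state: "t \<le> T \<Longrightarrow> sigma_finite_measure (Nx t)"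
  and sigma_finite_obs: "k \<in> K \<Longrightarrow> sigma_finite_measure (obs_sp m k)"
  and measurable_dyn: "t < T \<Longrightarrow> dyn m t \<in> Nx t \<Otimes>\<^sub>M Nu t \<Otimes>\<^sub>M noise_sp m \<rightarrow>\<^sub>M Nx (Suc t)"
  and measurable_sens: "t \<le> T \<Longrightarrow> k \<in> K \<Longrightarrow> sens m t k \<in> Nx t \<Otimes>\<^sub>M obs_noise_sp m k \<rightarrow>\<^sub>M obs_sp m k"
  and indep_noise: "prob_space.indep_vars M (\<lambda>_. noise_sp m) (noise_rv m) {..<T}"
  and indep_init: "indep_pair M (Nx 0) (init_rv m) (PiM {..<T} (\<lambda>_. noise_sp m))
      (\<lambda>\<omega>. \<lambda>t\<in>{..<T}. noise_rv m t \<omega>)"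
  and indep_obs_noise: "prob_space.indep_vars M (\<lambda>(t, k). obs_noise_sp m k)
      (\<lambda>(t, k). obs_noise_rv m t k) ({..T} \<times> K)"
  and indep_dyn_obs: "indep_pair M (Nx 0 \<Otimes>\<^sub>M PiM {..<T} (\<lambda>_. noise_sp m))
      (\<lambda>\<omega>. (init_rv m \<omega>, \<lambda>t\<in>{..<T}. noise_rv m t \<omega>))
      (PiM ({..T} \<times> K) (\<lambda>(t, k). obs_noise_sp m k))
      (\<lambda>\<omega>. \<lambda>(t, k)\<in>{..T} \<times> K. obs_noise_rv m t k \<omega>)"
  using model unfolding team_model_def Let_def by blast+

sublocale prob_space M by (rule prob_space_M)

lemma sigma_finite_joint_obs: "sigma_finite_measure Ny"
  unfolding joint_obs_sp_def by (intro sigma_finite_measure_PiM sigma_finite_obs) auto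

lemma measurable_init: "init_rv m \<in> M \<rightarrow>\<^sub>M Nx 0"
  using indep_init by (simp add: indep_pair_def)

lemma measurable_noise: "t < T \<Longrightarrow> noise_rv m t \<in> M \<rightarrow>\<^sub>M noise_sp m"
  using indep_noise by (simp add: indep_vars_def)

lemma measurable_obs_noise: "t \<le> T \<Longrightarrow> k \<in> K \<Longrightarrow> obs_noise_rv m t k \<in> M \<rightarrow>\<^sub>M obs_noise_sp m k"
  using indep_obs_noise by (auto simp: indep_vars_def)

subsection \<open>Independence of the sources of randomness\<close>

fun source_events :: "source \<Rightarrow> 'p set set" where
  "source_events Init = {init_rv m -` A \<inter> space M | A. A \<in> sets (Nx 0)}"
| "source_events (Dyn t) = {noise_rv m t -` A \<inter> space M | A. A \<in> sets (noise_sp m)}"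
| "source_events (Obs t k) = {obs_noise_rv m t k -` A \<inter> space M | A. A \<in> sets (obs_noise_sp m k)}"

definition sources :: "source set" where
  "sources = insert Init (Dyn ` {..<T} \<union> (\<lambda>(t, k). Obs t k) ` ({..T} \<times> K))"

lemma mem_sources[simp]:
  "Init \<in> sources" "Dyn t \<in> sources \<longleftrightarrow> t < T" "Obs t k \<in> sources \<longleftrightarrow> t \<le> T \<and> k \<in> K"
  by (auto simp: sources_def)

lemma source_events_subset: "i \<in> sources \<Longrightarrow> source_events i \<subseteq> events"
  by (cases i) (auto intro!: measurable_sets[OF measurable_init] measurable_sets[OF measurable_noise]
      measurable_sets[OF measurable_obs_noise])

lemma space_in_source_events: "i \<in> sources \<Longrightarrow> space M \<in> source_events i"
  using space_in_vimage[OF measurable_init] space_in_vimage[OF measurable_noise]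
    space_in_vimage[OF measurable_obs_noise]
  by (cases i) simp_all

lemma Int_stable_source_events: "Int_stable (source_events i)"
  by (cases i) (simp_all only: source_events.simps Int_stable_vimage)

text \<open>The hypotheses are nested: (X_0, W) against Z, then X_0 against W, then independence
  within W and within Z. On an intersection of one event per source, these four product formulas
  combine to the full product.\<close>

lemma indep_sources: "indep_sets source_events sources"
\<comment> \<open>The index set is finite and each class contains the whole space, so only
  intersections over all sources have to be tested; smaller ones arise by choosing the whole space
  elsewhere.\<close>
proof (subst indep_sets_finite)
  show "sources \<noteq> {}" "finite sources" by (simp_all add: sources_def)
  show "\<forall>A\<in>Pi sources source_events. prob (\<Inter>j\<in>sources. A j) = (\<Prod>j\<in>sources. prob (A j))"
  proof
    fix A assume A: "A \<in> Pi sources source_events"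
    have "A Init \<in> source_events Init" by (simp add: Pi_mem[OF A] del: source_events.simps)
    then obtain a where a: "a \<in> sets (Nx 0)" "A Init = init_rv m -` a \<inter> space M"
      by auto
    have "\<forall>t\<in>{..<T}. A (Dyn t) \<in> source_events (Dyn t)" by (simp add: Pi_mem[OF A] del: source_events.simps)
    then have "\<forall>t\<in>{..<T}. \<exists>b. b \<in> sets (noise_sp m) \<and> A (Dyn t) = noise_rv m t -` b \<inter> space M"
      by fastforce
    from bchoice[OF this] obtain b where b: "\<And>t. t < T \<Longrightarrow> b t \<in> sets (noise_sp m)"
        "\<And>t. t < T \<Longrightarrow> A (Dyn t) = noise_rv m t -` b t \<inter> space M"
      by (metis (no_types, lifting) lessThan_iff)
    have "\<forall>p\<in>{..T} \<times> K. A (Obs (fst p) (snd p)) \<in> source_events (Obs (fst p) (snd p))"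
      by (auto simp: Pi_mem[OF A] simp del: source_events.simps)
    then have "\<forall>p\<in>{..T} \<times> K. \<exists>c. c \<in> sets (obs_noise_sp m (snd p)) \<and>
        A (Obs (fst p) (snd p)) = obs_noise_rv m (fst p) (snd p) -` c \<inter> space M"
      by fastforce
    from bchoice[OF this] obtain c where c: "\<And>p. p \<in> {..T} \<times> K \<Longrightarrow> c p \<in> sets (obs_noise_sp m (snd p))"
        "\<And>p. p \<in> {..T} \<times> K \<Longrightarrow> A (Obs (fst p) (snd p)) = obs_noise_rv m (fst p) (snd p) -` c p \<inter> space M"
      by blast
    let ?W = "\<lambda>\<omega>. \<lambda>t\<in>{..<T}. noise_rv m t \<omega>" and ?Z = "\<lambda>\<omega>. \<lambda>(t, k)\<in>{..T} \<times> K. obs_noise_rv m t k \<omega>"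
    let ?b = "Pi\<^sub>E {..<T} b" and ?c = "Pi\<^sub>E ({..T} \<times> K) c"
    have sb: "?b \<in> sets (PiM {..<T} (\<lambda>_. noise_sp m))"
      by (rule sets_PiM_I_finite) (auto simp: b)
    have sc: "?c \<in> sets (PiM ({..T} \<times> K) (\<lambda>(t, k). obs_noise_sp m k))"
      using c(1) by (intro sets_PiM_I_finite) (auto split: prod.split)
    \<comment> \<open>The chosen events are collected into one box for each vector of noises, the
      form in which the independence of pairs is assumed.\<close>
    have inter: "(\<Inter>j\<in>sources. A j) =
        ((\<lambda>\<omega>. (init_rv m \<omega>, ?W \<omega>)) -` (a \<times> ?b) \<inter> space M) \<inter> (?Z -` ?c \<inter> space M)"
    proof (rule set_eqI)
      fix \<omega>
      have "\<omega> \<in> (\<Inter>j\<in>sources. A j) \<longleftrightarrow> \<omega> \<in> A Init \<and> (\<forall>t\<in>{..<T}. \<omega> \<in> A (Dyn t)) \<and>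
          (\<forall>p\<in>{..T} \<times> K. \<omega> \<in> A (Obs (fst p) (snd p)))"
        unfolding sources_def by auto
      also have "\<dots> \<longleftrightarrow> \<omega> \<in> init_rv m -` a \<inter> space M \<and> (\<forall>t\<in>{..<T}. \<omega> \<in> noise_rv m t -` b t \<inter> space M) \<and>
          (\<forall>p\<in>{..T} \<times> K. \<omega> \<in> obs_noise_rv m (fst p) (snd p) -` c p \<inter> space M)"
        using a(2) b(2) c(2) by simp
      also have "\<dots> \<longleftrightarrow> \<omega> \<in> ((\<lambda>\<omega>. (init_rv m \<omega>, ?W \<omega>)) -` (a \<times> ?b) \<inter> space M) \<inter> (?Z -` ?c \<inter> space M)"
        by (auto simp: PiE_iff)
      finally show "\<omega> \<in> (\<Inter>j\<in>sources. A j) \<longleftrightarrow> \<dots>" .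
    qed
    have p1: "prob (((\<lambda>\<omega>. (init_rv m \<omega>, ?W \<omega>)) -` (a \<times> ?b) \<inter> space M) \<inter> (?Z -` ?c \<inter> space M)) =
        prob ((\<lambda>\<omega>. (init_rv m \<omega>, ?W \<omega>)) -` (a \<times> ?b) \<inter> space M) * prob (?Z -` ?c \<inter> space M)"
      by (rule prob_indep_pair[OF indep_dyn_obs pair_measureI[OF a(1) sb] sc])
    have e1: "(\<lambda>\<omega>. (init_rv m \<omega>, ?W \<omega>)) -` (a \<times> ?b) \<inter> space M =
        (init_rv m -` a \<inter> space M) \<inter> (?W -` ?b \<inter> space M)"
      by (rule set_eqI) (simp only: vimage_eq Int_iff mem_Times_iff fst_conv snd_conv, blast)
    have p2: "prob ((init_rv m -` a \<inter> space M) \<inter> (?W -` ?b \<inter> space M)) =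
        prob (init_rv m -` a \<inter> space M) * prob (?W -` ?b \<inter> space M)"
      by (rule prob_indep_pair[OF indep_init a(1) sb])
    have e2: "?W -` ?b \<inter> space M = {\<omega> \<in> space M. \<forall>t\<in>{..<T}. noise_rv m t \<omega> \<in> b t}"
      by (rule vimage_restrict_PiE)
    have p3: "prob {\<omega> \<in> space M. \<forall>t\<in>{..<T}. noise_rv m t \<omega> \<in> b t} = (\<Prod>t<T. prob (A (Dyn t)))"
      by (subst prob_Int_indep_vars[OF indep_noise]) (simp_all add: b)
    have e3: "?Z -` ?c \<inter> space M = {\<omega> \<in> space M. \<forall>p\<in>{..T} \<times> K. (\<lambda>(t, k). obs_noise_rv m t k) p \<omega> \<in> c p}"
      unfolding vimage_restrict_PiE by (simp only: case_prod_beta)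
    have p4: "prob {\<omega> \<in> space M. \<forall>p\<in>{..T} \<times> K. (\<lambda>(t, k). obs_noise_rv m t k) p \<omega> \<in> c p} =
        (\<Prod>p\<in>{..T} \<times> K. prob (A (Obs (fst p) (snd p))))"
      using c by (subst prob_Int_indep_vars[OF indep_obs_noise]) (auto simp: case_prod_beta intro!: prod.cong)
    have p5: "prob (A Init) * ((\<Prod>t<T. prob (A (Dyn t))) *
        (\<Prod>p\<in>{..T} \<times> K. prob (A (Obs (fst p) (snd p))))) = (\<Prod>j\<in>sources. prob (A j))"
    proof -
      have "(\<Prod>j\<in>sources. prob (A j)) = prob (A Init) *
          (\<Prod>j\<in>Dyn ` {..<T} \<union> (\<lambda>(t, k). Obs t k) ` ({..T} \<times> K). prob (A j))"
        unfolding sources_def by (rule prod.insert) auto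
      also have "(\<Prod>j\<in>Dyn ` {..<T} \<union> (\<lambda>(t, k). Obs t k) ` ({..T} \<times> K). prob (A j)) =
          (\<Prod>j\<in>Dyn ` {..<T}. prob (A j)) * (\<Prod>j\<in>(\<lambda>(t, k). Obs t k) ` ({..T} \<times> K). prob (A j))"
        by (rule prod.union_disjoint) auto
      also have "(\<Prod>j\<in>Dyn ` {..<T}. prob (A j)) = (\<Prod>t<T. prob (A (Dyn t)))"
        by (subst prod.reindex) (auto simp: inj_on_def)
      also have "(\<Prod>j\<in>(\<lambda>(t, k). Obs t k) ` ({..T} \<times> K). prob (A j)) =
          (\<Prod>p\<in>{..T} \<times> K. prob (A (Obs (fst p) (snd p))))"
        by (subst prod.reindex) (auto simp: inj_on_def case_prod_beta)
      finally show ?thesis by simp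
    qed
    show "prob (\<Inter>j\<in>sources. A j) = (\<Prod>j\<in>sources. prob (A j))"
      unfolding p5[symmetric] inter p1 unfolding e1 p2 unfolding e2 p3 e3 p4 a(2) by (rule mult.assoc)
  qed
qed (use source_events_subset space_in_source_events in auto)

text \<open>The information carried by the sources in \<open>J\<close>. Measurability with respect
  to it stands for being a function of these sources alone, so that independence can be decided by
  disjointness of index sets.\<close>

definition source_algebra :: "source set \<Rightarrow> 'p measure" where
  "source_algebra J = sigma (space M) (\<Union>i\<in>J. source_events i)"

lemma source_events_Pow: "source_events i \<subseteq> Pow (space M)"
  by (cases i) auto

lemma space_source_algebra[simp]: "space (source_algebra J) = space M"
  unfolding source_algebra_def using source_events_Pow by (intro space_measure_of) blast

lemma sets_source_algebra: "sets (source_algebra J) = sigma_sets (space M) (\<Union>i\<in>J. source_events i)"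
  using source_events_Pow unfolding source_algebra_def by (intro sets_measure_of) blast

lemma measurable_source_algebra_mono:
  assumes "f \<in> source_algebra J \<rightarrow>\<^sub>M N" "J \<subseteq> J'"
  shows "f \<in> source_algebra J' \<rightarrow>\<^sub>M N"
proof -
  have "sets (source_algebra J) \<subseteq> sets (source_algebra J')"
    unfolding sets_source_algebra using assms(2) by (intro sigma_sets_mono') auto
  then show ?thesis using assms(1) by (auto simp: measurable_def)
qed

lemma measurable_from_source_algebra:
  assumes "f \<in> source_algebra J \<rightarrow>\<^sub>M N" "J \<subseteq> sources"
  shows "f \<in> M \<rightarrow>\<^sub>M N"
proof -
  have "sets (source_algebra J) \<subseteq> events"
    unfolding sets_source_algebra using assms(2) source_events_subset
    by (intro sets.sigma_sets_subset) auto
  then show ?thesis using assms(1) by (auto simp: measurable_def)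
qed

lemma measurable_sourceI:
  assumes "f \<in> M \<rightarrow>\<^sub>M N" "i \<in> J" "source_events i = {f -` A \<inter> space M | A. A \<in> sets N}"
  shows "f \<in> source_algebra J \<rightarrow>\<^sub>M N"
proof (rule measurableI)
  show "f x \<in> space N" if "x \<in> space (source_algebra J)" for x
    using measurable_space[OF assms(1)] that by simp
  show "f -` A \<inter> space (source_algebra J) \<in> sets (source_algebra J)" if "A \<in> sets N" for A
    unfolding sets_source_algebra space_source_algebra using assms(2,3) that
    by (intro sigma_sets.Basic) blast
qed

lemma measurable_source:
  shows measurable_source_init: "Init \<in> J \<Longrightarrow> init_rv m \<in> source_algebra J \<rightarrow>\<^sub>M Nx 0"
    and measurable_source_dyn: "t < T \<Longrightarrow> Dyn t \<in> J \<Longrightarrow> noise_rv m t \<in> source_algebra J \<rightarrow>\<^sub>M noise_sp m"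
    and measurable_source_obs: "t \<le> T \<Longrightarrow> k \<in> K \<Longrightarrow> Obs t k \<in> J \<Longrightarrow>
      obs_noise_rv m t k \<in> source_algebra J \<rightarrow>\<^sub>M obs_noise_sp m k"
  by (rule measurable_sourceI[OF measurable_init _ source_events.simps(1)]
      measurable_sourceI[OF measurable_noise _ source_events.simps(2)]
      measurable_sourceI[OF measurable_obs_noise _ source_events.simps(3)]; assumption)+

text \<open>The event classes of single sources are stable under intersection, so grouping the
  independent family into two disjoint blocks keeps the generated sigma-algebras independent;
  preimages under \<open>V\<close> and \<open>V'\<close> lie in these.\<close>

lemma indep_pair_source_algebra:
  assumes "J \<inter> J' = {}" "J \<union> J' \<subseteq> sources"
    and V: "V \<in> source_algebra J \<rightarrow>\<^sub>M N" and V': "V' \<in> source_algebra J' \<rightarrow>\<^sub>M N'"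
  shows "indep_pair M N V N' V'"
proof -
  have "indep_sets (\<lambda>b. sigma_sets (space M) (\<Union>i\<in>case_bool J J' b. source_events i)) UNIV"
    using assms(1,2) indep_sets_mono_index[OF _ indep_sources, of "\<Union>b. case_bool J J' b"]
    by (intro indep_sets_collect_sigma)
      (auto simp: Int_stable_source_events disjoint_family_on_def UNIV_bool split: bool.splits)
  then have "indep_set (sets (source_algebra J)) (sets (source_algebra J'))"
    unfolding indep_set_def sets_source_algebra
    by (rule indep_sets_cong[THEN iffD1, rotated 2]) (auto split: bool.splits)
  then have "indep_set {V -` A \<inter> space M | A. A \<in> sets N} {V' -` B \<inter> space M | B. B \<in> sets N'}"
    unfolding indep_set_def
    using measurable_sets[OF V] measurable_sets[OF V']
    by (elim indep_sets_mono_sets) (auto split: bool.splits)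
  moreover have "V \<in> M \<rightarrow>\<^sub>M N" "V' \<in> M \<rightarrow>\<^sub>M N'"
    using assms by (auto intro: measurable_from_source_algebra)
  ultimately show ?thesis by (simp add: indep_pair_def)
qed

text \<open>The sources that determine X_t. The observation noises of time \<open>t\<close> are left
  out, so that they are independent of X_t; Y_t and U_t add \<open>obs_sources t\<close>, and W_t
  enters only from \<open>Suc t\<close> on. The bound \<open>k \<in> K\<close> keeps the set within
  \<open>sources\<close>.\<close>

definition past :: "nat \<Rightarrow> source set" where
  "past t = {i. case i of Init \<Rightarrow> True | Dyn s \<Rightarrow> s < t | Obs s k \<Rightarrow> s < t \<and> k \<in> K}"

abbreviation obs_sources :: "nat \<Rightarrow> source set" where
  "obs_sources t \<equiv> Obs t ` K"

lemma past_Suc: "past (Suc t) = past t \<union> obs_sources t \<union> {Dyn t}"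
  by (auto simp: past_def less_Suc_eq split: source.splits)

lemma past_mono: "s < t \<Longrightarrow> past s \<union> obs_sources s \<subseteq> past t"
  by (auto simp: past_def split: source.splits)

lemma past_disjoint: "past t \<inter> obs_sources t = {}" "Dyn t \<notin> past t \<union> obs_sources t"
  by (auto simp: past_def)

lemma past_sources: "t \<le> T \<Longrightarrow> past t \<union> obs_sources t \<subseteq> sources"
  by (auto simp: past_def split: source.splits)

subsection \<open>The filter\<close>

definition lik :: "nat \<Rightarrow> (nat \<Rightarrow> 'y) \<Rightarrow> 'x \<Rightarrow> ennreal" where
  "lik t y x = (\<Prod>k\<in>K. r t k x (y k))"

definition predict :: "nat \<Rightarrow> ('x \<Rightarrow> ennreal) \<Rightarrow> (nat \<Rightarrow> 'u) \<Rightarrow> 'x \<Rightarrow> ennreal" where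
  "predict t \<pi> u x' = (\<integral>\<^sup>+ x. \<pi> x * q t (x, u) x' \<partial>Nx t)"

text \<open>The witness for \<theta>_t in the theorem. An observation with evidence 0 or \<infinity>
  leaves the prediction as it is.\<close>

definition filter_step :: "nat \<Rightarrow> ('x \<Rightarrow> ennreal) \<Rightarrow> (nat \<Rightarrow> 'y) \<Rightarrow> (nat \<Rightarrow> 'u) \<Rightarrow> 'x \<Rightarrow> ennreal" where
  "filter_step t \<pi> y u = bayes (Nx (Suc t)) (lik (Suc t) y) (predict t \<pi> u)"

text \<open>Time 0 already has a Bayes update, because Y_0 is known before the first decision. The
  step from \<open>t\<close> reads the observation of time \<open>Suc t\<close> and the decision of
  time \<open>t\<close>.\<close>

primrec posterior :: "nat \<Rightarrow> ('y, 'u) history \<Rightarrow> 'x \<Rightarrow> ennreal" where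
  "posterior 0 h = bayes (Nx 0) (lik 0 (fst h 0)) p0"
| "posterior (Suc t) h = filter_step t (posterior t h) (fst h (Suc t)) (snd h t)"

text \<open>Later entries of a history are never read. Hence a posterior can be evaluated on any
  longer history, which lets inductions keep one history fixed.\<close>

lemma posterior_cong:
  assumes "\<And>s. s \<le> t \<Longrightarrow> fst h s = fst h' s" "\<And>s. s < t \<Longrightarrow> snd h s = snd h' s"
  shows "posterior t h = posterior t h'"
  using assms by (induction t) simp_all

lemma measurable_lik:
  assumes "t \<le> T"
  shows "(\<lambda>(y, x). lik t y x) \<in> borel_measurable (Ny \<Otimes>\<^sub>M Nx t)"
proof -
  have [measurable]: "(\<lambda>(x, y). r t k x y) \<in> borel_measurable (Nx t \<Otimes>\<^sub>M obs_sp m k)" if "k \<in> K" for k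
    using sens_measurable[OF assms that] .
  show ?thesis unfolding lik_def joint_obs_sp_def by measurable
qed

text \<open>With the state frozen, the observation of member \<open>k\<close> is a function of Z_t^k
  alone, and these noises are independent; hence the densities multiply.\<close>

lemma distributed_lik:
  assumes t: "t \<le> T" and x: "x \<in> space (Nx t)"
  shows "distributed M Ny (\<lambda>\<omega>. \<lambda>k\<in>K. sens m t k (x, obs_noise_rv m t k \<omega>)) (\<lambda>y. lik t y x)"
  unfolding joint_obs_sp_def lik_def
proof (rule distributed_PiM)
  have "indep_sets source_events (Obs t ` K)"
    using t by (intro indep_sets_mono_index[OF _ indep_sources]) auto
  then have "indep_sets (\<lambda>k. source_events (Obs t k)) K"
    by (rule indep_sets_reindex[rotated]) (simp add: inj_on_def)
  then have "indep_vars (obs_noise_sp m) (obs_noise_rv m t) K"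
    using measurable_obs_noise[OF t] by (simp add: indep_vars_def2)
  then show "indep_vars (obs_sp m) (\<lambda>k \<omega>. sens m t k (x, obs_noise_rv m t k \<omega>)) K"
    using measurable_sens[OF t] x by (intro indep_vars_compose2[where Y="\<lambda>k z. sens m t k (x, z)"]) auto
qed (use t x sens sigma_finite_obs in auto)

lemma measurable_predict:
  assumes "t < T" and [measurable]: "(\<lambda>(h, x). \<pi> h x) \<in> borel_measurable (R \<Otimes>\<^sub>M Nx t)" "u \<in> R \<rightarrow>\<^sub>M Nu t"
  shows "(\<lambda>(h, x). predict t (\<pi> h) (u h) x) \<in> borel_measurable (R \<Otimes>\<^sub>M Nx (Suc t))"
proof -
  interpret N: sigma_finite_measure "Nx t" using assms(1) by (intro sigma_finite_state) simp
  note [measurable] = trans_measurable[OF assms(1)]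
  show ?thesis unfolding predict_def by measurable
qed

text \<open>Each \<open>q t (x, u)\<close> has mass 1, so by Tonelli's theorem the mass of \<pi> is
  preserved.\<close>

lemma prob_density_predict:
  assumes t: "t < T" and \<pi>: "prob_density (Nx t) \<pi>" and u: "u \<in> space (Nu t)"
  shows "prob_density (Nx (Suc t)) (predict t \<pi> u)"
proof -
  interpret N: sigma_finite_measure "Nx t" using t by (intro sigma_finite_state) simp
  interpret N': sigma_finite_measure "Nx (Suc t)" using t by (intro sigma_finite_state) simp
  interpret P: pair_sigma_finite "Nx t" "Nx (Suc t)" ..
  have [measurable]: "\<pi> \<in> borel_measurable (Nx t)" "u \<in> space (Nu t)" using \<pi> u by (auto simp: prob_density_def)
  note [measurable] = trans_measurable[OF t]
  have meas: "predict t \<pi> u \<in> borel_measurable (Nx (Suc t))"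
    unfolding predict_def by measurable
  have one: "(\<integral>\<^sup>+ x'. q t (x, u) x' \<partial>Nx (Suc t)) = 1" if "x \<in> space (Nx t)" for x
    using distributed_nn_integral[OF trans[OF t that u], of "\<lambda>_. 1"] by (simp add: emeasure_space_1)
  have "(\<integral>\<^sup>+ x'. predict t \<pi> u x' \<partial>Nx (Suc t)) =
      (\<integral>\<^sup>+ x. (\<integral>\<^sup>+ x'. \<pi> x * q t (x, u) x' \<partial>Nx (Suc t)) \<partial>Nx t)"
    unfolding predict_def by (intro P.Fubini') measurable
  also have "\<dots> = (\<integral>\<^sup>+ x. \<pi> x \<partial>Nx t)"
    by (intro nn_integral_cong, subst nn_integral_cmult) (auto simp: one)
  finally show ?thesis
    using meas \<pi> by (simp add: prob_density_def)
qed

lemma lik_borel: "t \<le> T \<Longrightarrow> y \<in> space Ny \<Longrightarrow> lik t y \<in> borel_measurable (Nx t)"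
  using measurable_compose[OF measurable_Pair1' measurable_lik] by simp

lemma prob_density_filter_step:
  assumes "t < T" "prob_density (Nx t) \<pi>" "y \<in> space Ny" "u \<in> space (Nu t)"
  shows "prob_density (Nx (Suc t)) (filter_step t \<pi> y u)"
  unfolding filter_step_def using assms by (intro prob_density_bayes prob_density_predict lik_borel) auto

text \<open>The old density occurs only under the integral in \<open>predict\<close>, so changing it
  on a null set alters the result nowhere. The update is thus well defined on densities up to almost
  everywhere equality.\<close>

lemma filter_step_cong_AE:
  assumes "AE x in Nx t. \<pi> x = \<pi>' x"
  shows "filter_step t \<pi> y u = filter_step t \<pi>' y u"
proof -
  have "predict t \<pi> u = predict t \<pi>' u"
    unfolding predict_def using assms by (intro ext nn_integral_cong_AE) (auto elim: eventually_mono)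
  then show ?thesis by (simp add: filter_step_def)
qed

subsection \<open>Histories\<close>

definition hist_sp :: "nat \<Rightarrow> ('y, 'u) history measure" where
  "hist_sp t = PiM {..t} (\<lambda>_. Ny) \<Otimes>\<^sub>M PiM {..<t} Nu"

abbreviation data_sp where
  "data_sp t \<equiv> shared_sp m t \<Otimes>\<^sub>M joint_private_sp m t"

definition pack :: "nat \<Rightarrow> ('y, 'u) history \<Rightarrow> ('y, 'u) shared_info \<times> (nat \<Rightarrow> ('y, 'u) private_info)" where
  "pack t h = ((\<lambda>s\<in>{s. s + delay m \<le> t}. fst h s, \<lambda>s\<in>{s. s + delay m \<le> t}. snd h s),
     \<lambda>k\<in>K. (\<lambda>s\<in>{s. t < s + delay m \<and> s \<le> t}. fst h s k, \<lambda>s\<in>{s. t < s + delay m \<and> s < t}. snd h s k))"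

text \<open>Times up to t - n are read from the shared part. At later times component
  \<open>k\<close> comes from the private part of member \<open>k\<close>, so the private data of
  all members have to be combined.\<close>

definition unpack :: "nat \<Rightarrow> ('y, 'u) shared_info \<times> (nat \<Rightarrow> ('y, 'u) private_info) \<Rightarrow> ('y, 'u) history" where
  "unpack t d =
     (\<lambda>s\<in>{..t}. \<lambda>k\<in>K. if s + delay m \<le> t then fst (fst d) s k else fst (snd d k) s,
      \<lambda>s\<in>{..<t}. \<lambda>k\<in>K. if s + delay m \<le> t then snd (fst d) s k else snd (snd d k) s)"

lemma measurable_obs_component[measurable]: "k \<in> K \<Longrightarrow> (\<lambda>y. y k) \<in> Ny \<rightarrow>\<^sub>M obs_sp m k"
  unfolding joint_obs_sp_def by measurable

lemma measurable_dec_component[measurable]: "k \<in> K \<Longrightarrow> (\<lambda>u. u k) \<in> Nu s \<rightarrow>\<^sub>M dec_sp m s k"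
  unfolding joint_dec_sp_def by measurable

lemma measurable_history_obs: "s \<le> t \<Longrightarrow> (\<lambda>h. fst h s) \<in> hist_sp t \<rightarrow>\<^sub>M Ny"
  unfolding hist_sp_def by (rule measurable_compose[OF measurable_fst measurable_component_singleton]) simp

lemma measurable_history_dec: "s < t \<Longrightarrow> (\<lambda>h. snd h s) \<in> hist_sp t \<rightarrow>\<^sub>M Nu s"
  unfolding hist_sp_def by (rule measurable_compose[OF measurable_snd measurable_component_singleton]) simp

lemma measurable_pack: "pack t \<in> hist_sp t \<rightarrow>\<^sub>M data_sp t"
proof -
  note compose = measurable_compose[OF measurable_history_obs measurable_obs_component]
    measurable_compose[OF measurable_history_dec measurable_dec_component]
  \<comment> \<open>A delay of at least 1 turns \<open>s + delay m \<le> t\<close> into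
    \<open>s < t\<close>, so the shared decisions are among those recorded in the history.\<close>
  show ?thesis
    unfolding pack_def shared_sp_def joint_private_sp_def private_sp_def
    using delay_ge_1
    by (intro measurable_Pair measurable_restrict compose measurable_history_obs measurable_history_dec) auto
qed

lemma measurable_unpack: "unpack t \<in> data_sp t \<rightarrow>\<^sub>M hist_sp t"
proof -
  have 1: "(\<lambda>d. fst (fst d) s k) \<in> data_sp t \<rightarrow>\<^sub>M obs_sp m k" if "s + delay m \<le> t" "k \<in> K" for s k
    unfolding shared_sp_def
    by (rule measurable_compose[OF _ measurable_obs_component[OF \<open>k \<in> K\<close>]],
        rule measurable_compose[OF measurable_compose[OF measurable_fst measurable_fst]
          measurable_component_singleton]) (use that in simp)
  have 2: "(\<lambda>d. snd (fst d) s k) \<in> data_sp t \<rightarrow>\<^sub>M dec_sp m s k" if "s + delay m \<le> t" "k \<in> K" for s k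
    unfolding shared_sp_def
    by (rule measurable_compose[OF _ measurable_dec_component[OF \<open>k \<in> K\<close>]],
        rule measurable_compose[OF measurable_compose[OF measurable_fst measurable_snd]
          measurable_component_singleton]) (use that in simp)
  have p: "(\<lambda>d. snd d k) \<in> data_sp t \<rightarrow>\<^sub>M private_sp m t k" if "k \<in> K" for k
    unfolding joint_private_sp_def
    by (rule measurable_compose[OF measurable_snd measurable_component_singleton[OF that]])
  have 3: "(\<lambda>d. fst (snd d k) s) \<in> data_sp t \<rightarrow>\<^sub>M obs_sp m k" if "\<not> s + delay m \<le> t" "s \<le> t" "k \<in> K" for s k
    by (rule measurable_compose[OF p[OF \<open>k \<in> K\<close>, unfolded private_sp_def]
          measurable_compose[OF measurable_fst measurable_component_singleton]]) (use that in simp)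
  have 4: "(\<lambda>d. snd (snd d k) s) \<in> data_sp t \<rightarrow>\<^sub>M dec_sp m s k" if "\<not> s + delay m \<le> t" "s < t" "k \<in> K" for s k
    by (rule measurable_compose[OF p[OF \<open>k \<in> K\<close>, unfolded private_sp_def]
          measurable_compose[OF measurable_snd measurable_component_singleton]]) (use that in simp)
  \<comment> \<open>The condition concerns the time only: for fixed \<open>s\<close>, one of the two
    branches is the entire function of \<open>d\<close>.\<close>
  have y: "(\<lambda>d. if s + delay m \<le> t then fst (fst d) s k else fst (snd d k) s) \<in> data_sp t \<rightarrow>\<^sub>M obs_sp m k"
    if "s \<in> {..t}" "k \<in> K" for s k
    using that 1[of s k] 3[of s k] by (cases "s + delay m \<le> t") simp_all
  have u: "(\<lambda>d. if s + delay m \<le> t then snd (fst d) s k else snd (snd d k) s) \<in> data_sp t \<rightarrow>\<^sub>M dec_sp m s k"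
    if "s \<in> {..<t}" "k \<in> K" for s k
    using that 2[of s k] 4[of s k] by (cases "s + delay m \<le> t") simp_all
  show ?thesis
    unfolding unpack_def hist_sp_def joint_obs_sp_def joint_dec_sp_def
    by (intro measurable_Pair measurable_restrict y u)
qed

text \<open>Delayed sharing merely redistributes the history among the members. Values off the index
  sets agree because elements of the product spaces are extensional.\<close>

lemma unpack_pack:
  assumes "h \<in> space (hist_sp t)"
  shows "unpack t (pack t h) = h"
proof -
  have y: "fst h \<in> extensional {..t}" "\<And>s. s \<le> t \<Longrightarrow> fst h s \<in> extensional K"
    and u: "snd h \<in> extensional {..<t}" "\<And>s. s < t \<Longrightarrow> snd h s \<in> extensional K"
    using assms by (auto simp: hist_sp_def space_pair_measure space_PiM PiE_def joint_obs_sp_def joint_dec_sp_def)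
  have "fst (unpack t (pack t h)) s k = fst h s k" for s k
    using y by (auto simp: unpack_def pack_def restrict_def extensional_def simp del: atLeastAtMost_iff)
  moreover have "snd (unpack t (pack t h)) s k = snd h s k" for s k
    using u by (auto simp: unpack_def pack_def restrict_def extensional_def simp del: atLeastAtMost_iff)
  ultimately show ?thesis by (simp add: prod_eq_iff fun_eq_iff)
qed

lemma measurable_posterior:
  assumes "t \<le> T"
  shows "(\<lambda>(h, x). posterior t h x) \<in> borel_measurable (hist_sp t \<Otimes>\<^sub>M Nx t)"
proof -
  \<comment> \<open>The induction runs over \<open>s\<close> with the history space of the final
    time \<open>t\<close> fixed, so all stages read coordinates of the same space.\<close>
  have "(\<lambda>(h, x). posterior s h x) \<in> borel_measurable (hist_sp t \<Otimes>\<^sub>M Nx s)" if "s \<le> t" for s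
    using that
  proof (induction s)
    case 0
    note [measurable] = measurable_lik[OF le0] distributed_borel_measurable[OF init] measurable_history_obs[OF le0, of t]
    show ?case unfolding posterior.simps
      by (rule measurable_bayes[OF sigma_finite_state[OF le0]]) measurable
  next
    case (Suc s)
    then have s: "s < T" "Suc s \<le> T" "s < t" using assms by auto
    note [measurable] = measurable_lik[OF s(2)] measurable_history_obs[OF Suc.prems] measurable_history_dec[OF s(3)]
      measurable_predict[OF s(1) Suc.IH[OF less_imp_le[OF s(3)]] measurable_history_dec[OF s(3)]]
    show ?case unfolding posterior.simps filter_step_def
      by (rule measurable_bayes[OF sigma_finite_state[OF s(2)]]) measurable
  qed
  then show ?thesis by simp
qed

text \<open>The fallback in \<open>bayes\<close> makes this true for each single history, including
  those of probability zero.\<close>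

lemma prob_density_posterior:
  assumes "t \<le> T" "h \<in> space (hist_sp t)"
  shows "prob_density (Nx t) (posterior t h)"
proof -
  have y: "fst h s \<in> space Ny" if "s \<le> t" for s
    using measurable_space[OF measurable_history_obs[OF that] assms(2)] .
  have u: "snd h s \<in> space (Nu s)" if "s < t" for s
    using measurable_space[OF measurable_history_dec[OF that] assms(2)] .
  have "prob_density (Nx s) (posterior s h)" if "s \<le> t" for s
    using that
  proof (induction s)
    case 0
    have "prob_density (Nx 0) p0"
      using distributed_borel_measurable[OF init] distributed_nn_integral[OF init, of "\<lambda>_. 1"]
      by (simp add: prob_density_def emeasure_space_1)
    then show ?case by (simp add: prob_density_bayes lik_borel y)
  next
    case (Suc s)
    then show ?case using assms(1) y u by (auto intro!: prob_density_filter_step)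
  qed
  then show ?thesis by simp
qed

definition info_state where
  "info_state t d = posterior t (unpack t d)"

lemma measurable_info_state:
  assumes "t \<le> T"
  shows "(\<lambda>(d, x). info_state t d x) \<in> borel_measurable (data_sp t \<Otimes>\<^sub>M Nx t)"
proof -
  note [measurable] = measurable_posterior[OF assms] measurable_unpack[of t]
  show ?thesis unfolding info_state_def by measurable
qed

lemma prob_density_info_state:
  "t \<le> T \<Longrightarrow> d \<in> space (data_sp t) \<Longrightarrow> prob_density (Nx t) (info_state t d)"
  unfolding info_state_def by (intro prob_density_posterior measurable_space[OF measurable_unpack])

end

subsection \<open>The closed loop\<close>

locale team_loop = team_filter m p0 q r
  for m :: "('p, 'x, 'u, 'y, 'w, 'z) team" and p0 q r +
  fixes g X Y U
  assumes strategy: "g \<in> strategies m" and loop: "closed_loop m g X Y U"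
begin

lemma X_0: "\<omega> \<in> space M \<Longrightarrow> X 0 \<omega> = init_rv m \<omega>"
  and X_Suc: "t < T \<Longrightarrow> \<omega> \<in> space M \<Longrightarrow> X (Suc t) \<omega> = dyn m t (X t \<omega>, U t \<omega>, noise_rv m t \<omega>)"
  and Y_eq: "t \<le> T \<Longrightarrow> \<omega> \<in> space M \<Longrightarrow> Y t \<omega> = (\<lambda>k\<in>K. sens m t k (X t \<omega>, obs_noise_rv m t k \<omega>))"
  and U_eq: "t < T \<Longrightarrow> \<omega> \<in> space M \<Longrightarrow> U t \<omega> = g t (private_data m t Y U \<omega>, shared_data m t Y U \<omega>)"
  using loop unfolding closed_loop_def by blast+

definition hist :: "nat \<Rightarrow> 'p \<Rightarrow> ('y, 'u) history" where
  "hist t \<omega> = (\<lambda>s\<in>{..t}. Y s \<omega>, \<lambda>s\<in>{..<t}. U s \<omega>)"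

text \<open>Strategies expect the private data first, whereas \<open>pack\<close> puts the shared
  data first; hence the swap.\<close>

definition control :: "nat \<Rightarrow> ('y, 'u) history \<Rightarrow> nat \<Rightarrow> 'u" where
  "control t h = g t (prod.swap (pack t h))"

text \<open>As the delay is at least 1, shared times satisfy \<open>s < t\<close>; cutting the
  decisions down to \<open>{..<t}\<close> therefore loses none of the shared ones.\<close>

lemma data_eq_pack: "(shared_data m t Y U \<omega>, private_data m t Y U \<omega>) = pack t (hist t \<omega>)"
  using delay_ge_1 by (auto simp: pack_def hist_def shared_data_def private_data_def fun_eq_iff)

lemma U_eq_control: "t < T \<Longrightarrow> \<omega> \<in> space M \<Longrightarrow> U t \<omega> = control t (hist t \<omega>)"
  by (simp add: control_def U_eq data_eq_pack[symmetric])

lemma measurable_control: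
  assumes "t < T"
  shows "control t \<in> hist_sp t \<rightarrow>\<^sub>M Nu t"
proof -
  have [measurable]: "g t \<in> joint_private_sp m t \<Otimes>\<^sub>M shared_sp m t \<rightarrow>\<^sub>M Nu t"
    using strategy assms by (auto simp: strategies_def)
  note [measurable] = measurable_pack[of t]
  show ?thesis unfolding control_def prod.swap_def by measurable
qed

section \<open>Adaptedness of the closed loop to the sources\<close>

lemma measurable_histI:
  assumes "\<And>s. s \<le> t \<Longrightarrow> Y s \<in> A \<rightarrow>\<^sub>M Ny" "\<And>s. s < t \<Longrightarrow> U s \<in> A \<rightarrow>\<^sub>M Nu s"
  shows "hist t \<in> A \<rightarrow>\<^sub>M hist_sp t"
  unfolding hist_def hist_sp_def using assms by (intro measurable_Pair measurable_restrict) auto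

text \<open>The induction is over all earlier times, since U_t depends on the complete history. The
  closed-loop equations hold on the sample space only, so measurability is transferred by
  \<open>measurable_cong\<close>.\<close>

lemma adapted:
  assumes "t \<le> T"
  shows adapted_X: "X t \<in> source_algebra (past t) \<rightarrow>\<^sub>M Nx t"
    and adapted_Y: "Y t \<in> source_algebra (past t \<union> obs_sources t) \<rightarrow>\<^sub>M Ny"
    and adapted_U: "t < T \<Longrightarrow> U t \<in> source_algebra (past t \<union> obs_sources t) \<rightarrow>\<^sub>M Nu t"
proof -
  have "X t \<in> source_algebra (past t) \<rightarrow>\<^sub>M Nx t \<and> Y t \<in> source_algebra (past t \<union> obs_sources t) \<rightarrow>\<^sub>M Ny \<and>
      (t < T \<longrightarrow> U t \<in> source_algebra (past t \<union> obs_sources t) \<rightarrow>\<^sub>M Nu t)"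
    using assms
  proof (induction t rule: less_induct)
    case (less t)
    have X: "X t \<in> source_algebra (past t) \<rightarrow>\<^sub>M Nx t"
    proof (cases t)
      case 0
      have "X t \<in> source_algebra (past t) \<rightarrow>\<^sub>M Nx t \<longleftrightarrow> init_rv m \<in> source_algebra (past t) \<rightarrow>\<^sub>M Nx t"
        by (intro measurable_cong) (simp add: X_0 0)
      then show ?thesis using 0 by (simp add: measurable_source_init past_def)
    next
      case (Suc s)
      then have s: "s < T" "s \<le> T" "s < t" using less.prems by auto
      note sub = past_mono[OF s(3)]
      have [measurable]: "X s \<in> source_algebra (past t) \<rightarrow>\<^sub>M Nx s" "U s \<in> source_algebra (past t) \<rightarrow>\<^sub>M Nu s"
        using less.IH[OF s(3,2)] s(1) sub by (auto intro: measurable_source_algebra_mono)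
      have [measurable]: "noise_rv m s \<in> source_algebra (past t) \<rightarrow>\<^sub>M noise_sp m"
        using s by (intro measurable_source_dyn) (auto simp: past_def)
      note [measurable] = measurable_dyn[OF s(1)]
      have dyn: "(\<lambda>\<omega>. dyn m s (X s \<omega>, U s \<omega>, noise_rv m s \<omega>)) \<in> source_algebra (past t) \<rightarrow>\<^sub>M Nx (Suc s)"
        by measurable
      have "X t \<in> source_algebra (past t) \<rightarrow>\<^sub>M Nx t \<longleftrightarrow>
          (\<lambda>\<omega>. dyn m s (X s \<omega>, U s \<omega>, noise_rv m s \<omega>)) \<in> source_algebra (past t) \<rightarrow>\<^sub>M Nx t"
        by (intro measurable_cong) (simp add: X_Suc[OF s(1)] Suc)
      also have "\<dots>" using dyn Suc by simp
      finally show ?thesis .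
    qed
    have Y: "Y t \<in> source_algebra (past t \<union> obs_sources t) \<rightarrow>\<^sub>M Ny"
    proof -
      have [measurable]: "X t \<in> source_algebra (past t \<union> obs_sources t) \<rightarrow>\<^sub>M Nx t"
        using X by (rule measurable_source_algebra_mono) simp
      have [measurable]: "obs_noise_rv m t k \<in> source_algebra (past t \<union> obs_sources t) \<rightarrow>\<^sub>M obs_noise_sp m k"
        "sens m t k \<in> Nx t \<Otimes>\<^sub>M obs_noise_sp m k \<rightarrow>\<^sub>M obs_sp m k" if "k \<in> K" for k
        using less.prems that by (auto intro!: measurable_source_obs measurable_sens)
      have "Y t \<in> source_algebra (past t \<union> obs_sources t) \<rightarrow>\<^sub>M Ny \<longleftrightarrow>
          (\<lambda>\<omega>. \<lambda>k\<in>K. sens m t k (X t \<omega>, obs_noise_rv m t k \<omega>)) \<in> source_algebra (past t \<union> obs_sources t) \<rightarrow>\<^sub>M Ny"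
        by (intro measurable_cong) (simp add: Y_eq[OF less.prems])
      also have "\<dots>" unfolding joint_obs_sp_def by measurable
      finally show ?thesis .
    qed
    have "U t \<in> source_algebra (past t \<union> obs_sources t) \<rightarrow>\<^sub>M Nu t" if "t < T"
    proof -
      have "Y s \<in> source_algebra (past t \<union> obs_sources t) \<rightarrow>\<^sub>M Ny" if "s \<le> t" for s
      proof (cases "s = t")
        case False
        then have "s < t" using that by simp
        then have "Y s \<in> source_algebra (past s \<union> obs_sources s) \<rightarrow>\<^sub>M Ny"
          using less.IH[of s] less.prems by simp
        then show ?thesis
          by (rule measurable_source_algebra_mono) (use past_mono[OF \<open>s < t\<close>] in auto)
      qed (use Y in simp)
      moreover have "U s \<in> source_algebra (past t \<union> obs_sources t) \<rightarrow>\<^sub>M Nu s" if "s < t" for s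
      proof -
        have "U s \<in> source_algebra (past s \<union> obs_sources s) \<rightarrow>\<^sub>M Nu s"
          using less.IH[of s] less.prems that by simp
        then show ?thesis
          by (rule measurable_source_algebra_mono) (use past_mono[OF that] in auto)
      qed
      ultimately have H: "hist t \<in> source_algebra (past t \<union> obs_sources t) \<rightarrow>\<^sub>M hist_sp t"
        by (rule measurable_histI)
      have "U t \<in> source_algebra (past t \<union> obs_sources t) \<rightarrow>\<^sub>M Nu t \<longleftrightarrow>
          (\<lambda>\<omega>. control t (hist t \<omega>)) \<in> source_algebra (past t \<union> obs_sources t) \<rightarrow>\<^sub>M Nu t"
        by (intro measurable_cong) (simp add: U_eq_control[OF that])
      then show ?thesis
        using measurable_compose[OF H measurable_control[OF that]] by simp
    qed
    with X Y show ?case by simp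
  qed
  then show "X t \<in> source_algebra (past t) \<rightarrow>\<^sub>M Nx t"
    "Y t \<in> source_algebra (past t \<union> obs_sources t) \<rightarrow>\<^sub>M Ny"
    "t < T \<Longrightarrow> U t \<in> source_algebra (past t \<union> obs_sources t) \<rightarrow>\<^sub>M Nu t"
    by auto
qed

lemma adapted_hist:
  assumes "t \<le> T"
  shows "hist t \<in> source_algebra (past t \<union> obs_sources t) \<rightarrow>\<^sub>M hist_sp t"
proof (rule measurable_histI)
  have sub: "past s \<union> obs_sources s \<subseteq> past t \<union> obs_sources t" if "s \<le> t" for s
    using that by (auto simp: past_def le_less split: source.splits)
  show "Y s \<in> source_algebra (past t \<union> obs_sources t) \<rightarrow>\<^sub>M Ny" if "s \<le> t" for s
    using measurable_source_algebra_mono[OF adapted_Y sub[OF that]] that assms by simp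
  show "U s \<in> source_algebra (past t \<union> obs_sources t) \<rightarrow>\<^sub>M Nu s" if "s < t" for s
    using measurable_source_algebra_mono[OF adapted_U sub] that assms by simp
qed

lemma measurable_hist: "t \<le> T \<Longrightarrow> hist t \<in> M \<rightarrow>\<^sub>M hist_sp t"
  by (rule measurable_from_source_algebra[OF adapted_hist past_sources])

lemma hist_in_space: "t \<le> T \<Longrightarrow> \<omega> \<in> space M \<Longrightarrow> hist t \<omega> \<in> space (hist_sp t)"
  by (rule measurable_space[OF measurable_hist])

text \<open>\<open>V\<close> may be any function of sources other than the observation noises of
  time \<open>t\<close>; these are then independent of \<open>V\<close> and X_t together, so that
  only X_t influences the density. The lemma is applied with trivial information at time 0 and with
  the preceding history afterwards.\<close>

lemma cond_kernel_obs:
  assumes t: "t \<le> T" and V: "V \<in> source_algebra J \<rightarrow>\<^sub>M R" and J: "J \<subseteq> sources" "past t \<subseteq> J" "J \<inter> obs_sources t = {}"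
  shows "cond_kernel M (R \<Otimes>\<^sub>M Nx t) Ny (\<lambda>\<omega>. (V \<omega>, X t \<omega>)) (Y t) (\<lambda>(h, x) y. lik t y x)"
proof (rule cond_kernel_indep)
  have "(\<lambda>\<omega>. (V \<omega>, X t \<omega>)) \<in> source_algebra J \<rightarrow>\<^sub>M R \<Otimes>\<^sub>M Nx t"
    using V measurable_source_algebra_mono[OF adapted_X[OF t] J(2)] by (rule measurable_Pair)
  moreover have "(\<lambda>\<omega>. \<lambda>k\<in>K. obs_noise_rv m t k \<omega>) \<in> source_algebra (obs_sources t) \<rightarrow>\<^sub>M PiM K (obs_noise_sp m)"
    using t by (intro measurable_restrict measurable_source_obs) auto
  ultimately show "indep_pair M (R \<Otimes>\<^sub>M Nx t) (\<lambda>\<omega>. (V \<omega>, X t \<omega>)) (PiM K (obs_noise_sp m))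
      (\<lambda>\<omega>. \<lambda>k\<in>K. obs_noise_rv m t k \<omega>)"
    by (rule indep_pair_source_algebra[rotated 2]) (use J t in auto)
  have [measurable]: "sens m t k \<in> Nx t \<Otimes>\<^sub>M obs_noise_sp m k \<rightarrow>\<^sub>M obs_sp m k" if "k \<in> K" for k
    by (rule measurable_sens[OF t that])
  show "(\<lambda>(v, z). \<lambda>k\<in>K. sens m t k (snd v, z k)) \<in> (R \<Otimes>\<^sub>M Nx t) \<Otimes>\<^sub>M PiM K (obs_noise_sp m) \<rightarrow>\<^sub>M Ny"
    unfolding joint_obs_sp_def by measurable
  note [measurable] = measurable_lik[OF t]
  show "(\<lambda>(v, y). (case v of (h, x) \<Rightarrow> \<lambda>y. lik t y x) y) \<in> borel_measurable ((R \<Otimes>\<^sub>M Nx t) \<Otimes>\<^sub>M Ny)"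
    unfolding case_prod_beta by measurable
  show "distributed M Ny (\<lambda>\<omega>. case (v, \<lambda>k\<in>K. obs_noise_rv m t k \<omega>) of
      (v, z) \<Rightarrow> \<lambda>k\<in>K. sens m t k (snd v, z k)) (case v of (h, x) \<Rightarrow> \<lambda>y. lik t y x)"
    if "v \<in> space (R \<Otimes>\<^sub>M Nx t)" for v
    using distributed_lik[OF t, of "snd v"] that
    by (auto simp: space_pair_measure cong: restrict_cong)
  show "Y t \<omega> = (case ((V \<omega>, X t \<omega>), \<lambda>k\<in>K. obs_noise_rv m t k \<omega>) of
      (v, z) \<Rightarrow> \<lambda>k\<in>K. sens m t k (snd v, z k))" if "\<omega> \<in> space M" for \<omega>
    using Y_eq[OF t that] by (auto cong: restrict_cong)
qed (rule sigma_finite_joint_obs)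

text \<open>W_t is not among the sources of the history and of X_t. Holding the history fixed also
  fixes the decision, so the strategy appears only in the argument \<open>control t h\<close> of the
  strategy-free \<open>q\<close>.\<close>

lemma cond_kernel_dyn:
  assumes t: "t < T"
  shows "cond_kernel M (hist_sp t \<Otimes>\<^sub>M Nx t) (Nx (Suc t)) (\<lambda>\<omega>. (hist t \<omega>, X t \<omega>)) (X (Suc t))
    (\<lambda>(h, x). q t (x, control t h))"
proof (rule cond_kernel_indep)
  note [measurable] = measurable_control[OF t] measurable_dyn[OF t] trans_measurable[OF t]
  have "(\<lambda>\<omega>. (hist t \<omega>, X t \<omega>)) \<in> source_algebra (past t \<union> obs_sources t) \<rightarrow>\<^sub>M hist_sp t \<Otimes>\<^sub>M Nx t"
    using t by (intro measurable_Pair adapted_hist measurable_source_algebra_mono[OF adapted_X]) auto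
  moreover have "noise_rv m t \<in> source_algebra {Dyn t} \<rightarrow>\<^sub>M noise_sp m"
    using t by (intro measurable_source_dyn) auto
  ultimately show "indep_pair M (hist_sp t \<Otimes>\<^sub>M Nx t) (\<lambda>\<omega>. (hist t \<omega>, X t \<omega>)) (noise_sp m) (noise_rv m t)"
    by (rule indep_pair_source_algebra[rotated 2])
      (use past_sources[of t] past_disjoint(2)[of t] t in auto)
  show "sigma_finite_measure (Nx (Suc t))" using t by (intro sigma_finite_state) simp
  show "(\<lambda>z. dyn m t (snd (fst z), control t (fst (fst z)), snd z)) \<in> (hist_sp t \<Otimes>\<^sub>M Nx t) \<Otimes>\<^sub>M noise_sp m \<rightarrow>\<^sub>M Nx (Suc t)"
    by measurable
  show "(\<lambda>(v, x'). (case v of (h, x) \<Rightarrow> q t (x, control t h)) x') \<in> borel_measurable ((hist_sp t \<Otimes>\<^sub>M Nx t) \<Otimes>\<^sub>M Nx (Suc t))"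
    unfolding case_prod_beta by measurable
  show "distributed M (Nx (Suc t)) 
      (\<lambda>\<omega>. dyn m t (snd (fst (v, noise_rv m t \<omega>)), control t (fst (fst (v, noise_rv m t \<omega>))), snd (v, noise_rv m t \<omega>)))
      (case v of (h, x) \<Rightarrow> q t (x, control t h))" if "v \<in> space (hist_sp t \<Otimes>\<^sub>M Nx t)" for v
    using that trans[OF t] measurable_space[OF measurable_control[OF t]]
    by (auto simp: space_pair_measure)
  show "X (Suc t) \<omega> = dyn m t (snd (fst ((hist t \<omega>, X t \<omega>), noise_rv m t \<omega>)),
      control t (fst (fst ((hist t \<omega>, X t \<omega>), noise_rv m t \<omega>))), snd ((hist t \<omega>, X t \<omega>), noise_rv m t \<omega>))"
    if "\<omega> \<in> space M" for \<omega>
    using that by (simp add: X_Suc[OF t] U_eq_control[OF t])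
qed

text \<open>Conditioning on the constant \<open>()\<close> represents having observed nothing. Given
  it, \<open>p0\<close> is the density of X_0, and the first observation is handled by the same
  Bayes step as all others.\<close>

lemma cond_kernel_posterior_0: "cond_kernel M (hist_sp 0) (Nx 0) (hist 0) (X 0) (posterior 0)"
proof -
  let ?R = "count_space (UNIV :: unit set)"
  have [measurable]: "init_rv m \<in> M \<rightarrow>\<^sub>M Nx 0" "p0 \<in> borel_measurable (Nx 0)"
    by (rule measurable_init, rule distributed_borel_measurable[OF init])
  have X: "X 0 \<in> M \<rightarrow>\<^sub>M Nx 0"
    by (rule measurable_from_source_algebra[OF adapted_X]) (use past_sources[of 0] in auto)
  have "(\<integral>\<^sup>+ \<omega>. F ((), X 0 \<omega>) \<partial>M) = (\<integral>\<^sup>+ \<omega>. (\<integral>\<^sup>+ x. F ((), x) * p0 x \<partial>Nx 0) \<partial>M)"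
    if [measurable]: "F \<in> borel_measurable (?R \<Otimes>\<^sub>M Nx 0)" for F
  proof -
    have "(\<integral>\<^sup>+ \<omega>. F ((), X 0 \<omega>) \<partial>M) = (\<integral>\<^sup>+ \<omega>. F ((), init_rv m \<omega>) \<partial>M)"
      by (intro nn_integral_cong) (simp add: X_0)
    also have "\<dots> = (\<integral>\<^sup>+ x. p0 x * F ((), x) \<partial>Nx 0)"
      by (rule distributed_nn_integral[OF init, symmetric]) measurable
    finally show ?thesis by (simp add: emeasure_space_1 mult.commute)
  qed
  then have prior: "cond_kernel M ?R (Nx 0) (\<lambda>_. ()) (X 0) (\<lambda>_. p0)"
    using X by (simp add: cond_kernel_def)
  have "cond_kernel M (?R \<Otimes>\<^sub>M Nx 0) Ny (\<lambda>\<omega>. ((), X 0 \<omega>)) (Y 0) (\<lambda>(h, x) y. lik 0 y x)"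
    using past_sources[of 0] past_disjoint(1)[of 0] by (intro cond_kernel_obs[where J="past 0"]) auto
  from cond_kernel_bayes[OF prob_space_M sigma_finite_state[OF le0] sigma_finite_joint_obs prior this
      measurable_lik[OF le0]]
  show ?thesis
  proof (rule cond_kernel_image)
    \<comment> \<open>A single observation becomes a history of length one. Its decision part is the
      only extensional function on the empty index set.\<close>
    show "(\<lambda>z. (\<lambda>s\<in>{..0}. snd z, \<lambda>s\<in>{..<0}. undefined)) \<in> ?R \<Otimes>\<^sub>M Ny \<rightarrow>\<^sub>M hist_sp 0"
      unfolding hist_sp_def by (intro measurable_Pair measurable_restrict) auto
    show "(\<lambda>(h, x). posterior 0 h x) \<in> borel_measurable (hist_sp 0 \<Otimes>\<^sub>M Nx 0)"
      by (rule measurable_posterior) simp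
  qed (auto simp: hist_def cong: restrict_cong)
qed

text \<open>The new history carries the same information as the old one with Y_{t+1}, since U_t is a
  function of the old one. It is therefore enough to predict, apply Bayes' rule for Y_{t+1}, and
  append both entries by \<open>cond_kernel_image\<close>.\<close>

lemma cond_kernel_posterior_Suc:
  assumes t: "t < T" and IH: "cond_kernel M (hist_sp t) (Nx t) (hist t) (X t) (posterior t)"
  shows "cond_kernel M (hist_sp (Suc t)) (Nx (Suc t)) (hist (Suc t)) (X (Suc t)) (posterior (Suc t))"
proof -
  have t': "t \<le> T" "Suc t \<le> T" using t by auto
  have pred: "cond_kernel M (hist_sp t) (Nx (Suc t)) (hist t) (X (Suc t)) (\<lambda>h. predict t (posterior t h) (control t h))"
    using cond_kernel_predict[OF sigma_finite_state[OF t'(1)] sigma_finite_state[OF t'(2)] IH cond_kernel_dyn[OF t]]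
    by (simp add: predict_def[abs_def])
  have "cond_kernel M (hist_sp t \<Otimes>\<^sub>M Nx (Suc t)) Ny (\<lambda>\<omega>. (hist t \<omega>, X (Suc t) \<omega>)) (Y (Suc t))
      (\<lambda>(h, x) y. lik (Suc t) y x)"
  proof (rule cond_kernel_obs[OF t'(2), where J="past (Suc t)"])
    show "hist t \<in> source_algebra (past (Suc t)) \<rightarrow>\<^sub>M hist_sp t"
      by (rule measurable_source_algebra_mono[OF adapted_hist[OF t'(1)]]) (auto simp: past_Suc)
  qed (use past_sources[OF t'(2)] past_disjoint(1) in auto)
  from cond_kernel_bayes[OF prob_space_M sigma_finite_state[OF t'(2)] sigma_finite_joint_obs pred this measurable_lik[OF t'(2)]]
  show ?thesis
  proof (rule cond_kernel_image)
    note [measurable] = measurable_control[OF t]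
    have "(\<lambda>z. (fst (fst z))(Suc t := snd z)) \<in> hist_sp t \<Otimes>\<^sub>M Ny \<rightarrow>\<^sub>M PiM {..Suc t} (\<lambda>_. Ny)"
      by (rule measurable_fun_upd[where J="{..t}"]) (auto simp: hist_sp_def)
    \<comment> \<open>The appended decision is recomputed from the old history; on the sample space
      it equals U_t.\<close>
    moreover have "(\<lambda>z. (snd (fst z))(t := control t (fst z))) \<in> hist_sp t \<Otimes>\<^sub>M Ny \<rightarrow>\<^sub>M PiM {..<Suc t} Nu"
    proof (rule measurable_fun_upd[where J="{..<t}"])
      show "(\<lambda>z. snd (fst z)) \<in> hist_sp t \<Otimes>\<^sub>M Ny \<rightarrow>\<^sub>M PiM {..<t} Nu"
        unfolding hist_sp_def by measurable
      show "(\<lambda>z. control t (fst z)) \<in> hist_sp t \<Otimes>\<^sub>M Ny \<rightarrow>\<^sub>M Nu t"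
        by measurable
    qed auto
    ultimately show "(\<lambda>z. ((fst (fst z))(Suc t := snd z), (snd (fst z))(t := control t (fst z))))
        \<in> hist_sp t \<Otimes>\<^sub>M Ny \<rightarrow>\<^sub>M hist_sp (Suc t)"
      unfolding hist_sp_def[of "Suc t"] by (rule measurable_Pair)
    show "(\<lambda>(h, x). posterior (Suc t) h x) \<in> borel_measurable (hist_sp (Suc t) \<Otimes>\<^sub>M Nx (Suc t))"
      by (rule measurable_posterior) fact
    show "hist (Suc t) \<omega> = ((fst (fst (hist t \<omega>, Y (Suc t) \<omega>)))(Suc t := snd (hist t \<omega>, Y (Suc t) \<omega>)),
        (snd (fst (hist t \<omega>, Y (Suc t) \<omega>)))(t := control t (fst (hist t \<omega>, Y (Suc t) \<omega>))))"
      if "\<omega> \<in> space M" for \<omega>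
      using U_eq_control[OF t that] by (auto simp: hist_def fun_eq_iff restrict_def)
    show "posterior (Suc t) ((fst (fst z))(Suc t := snd z), (snd (fst z))(t := control t (fst z))) =
        (case z of (h, y) \<Rightarrow> bayes (Nx (Suc t)) (lik (Suc t) y) (predict t (posterior t h) (control t h)))" for z
    proof -
      have "posterior t ((fst (fst z))(Suc t := snd z), (snd (fst z))(t := control t (fst z))) = posterior t (fst z)"
        by (rule posterior_cong) auto
      then show ?thesis by (simp add: filter_step_def case_prod_beta)
    qed
  qed auto
qed

lemma cond_kernel_posterior: "t \<le> T \<Longrightarrow> cond_kernel M (hist_sp t) (Nx t) (hist t) (X t) (posterior t)"
  by (induction t) (auto intro: cond_kernel_posterior_0 cond_kernel_posterior_Suc)

lemma info_state_pack: "t \<le> T \<Longrightarrow> \<omega> \<in> space M \<Longrightarrow> info_state t (pack t (hist t \<omega>)) = posterior t (hist t \<omega>)"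
  by (simp add: info_state_def unpack_pack hist_in_space)

text \<open>Along \<open>pack\<close> the map \<open>info_state\<close> agrees with the posterior,
  so the kernel for histories carries over to the data held by the team.\<close>

lemma cond_density_info_state:
  assumes t: "t \<le> T"
  shows "cond_density M (data_sp t) (Nx t) (\<lambda>\<omega>. (shared_data m t Y U \<omega>, private_data m t Y U \<omega>)) (X t) (info_state t)"
proof (rule cond_kernel_imp_cond_density[OF prob_space_M sigma_finite_state[OF t]])
  show "cond_kernel M (data_sp t) (Nx t) (\<lambda>\<omega>. (shared_data m t Y U \<omega>, private_data m t Y U \<omega>)) (X t) (info_state t)"
    by (rule cond_kernel_image[OF cond_kernel_posterior[OF t] measurable_pack data_eq_pack _ measurable_info_state[OF t]])
      (auto simp: info_state_def unpack_pack)
qed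

text \<open>This holds at every sample point because it is the defining recursion of
  \<open>posterior\<close>; U_t is read from the recorded history, without consulting the
  strategy.\<close>

lemma info_state_step:
  assumes t: "t < T" and \<omega>: "\<omega> \<in> space M"
  shows "info_state (Suc t) (shared_data m (Suc t) Y U \<omega>, private_data m (Suc t) Y U \<omega>) =
    filter_step t (info_state t (shared_data m t Y U \<omega>, private_data m t Y U \<omega>)) (Y (Suc t) \<omega>) (U t \<omega>)"
proof -
  have "posterior t (hist (Suc t) \<omega>) = posterior t (hist t \<omega>)"
    by (rule posterior_cong) (auto simp: hist_def)
  then show ?thesis
    using t \<omega> by (simp add: data_eq_pack info_state_pack) (simp add: hist_def)
qed

end

theorem theorem1:
  fixes m :: "('p, 'x, 'u, 'y, 'w, 'z) team"
  assumes "team_model m"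
  shows "\<exists>\<Psi> :: nat \<Rightarrow> ('y, 'u) shared_info \<times> (nat \<Rightarrow> ('y, 'u) private_info) \<Rightarrow> 'x \<Rightarrow> ennreal.
         \<exists>\<theta> :: nat \<Rightarrow> ('x \<Rightarrow> ennreal) \<Rightarrow> (nat \<Rightarrow> 'y) \<Rightarrow> (nat \<Rightarrow> 'u) \<Rightarrow> 'x \<Rightarrow> ennreal.
    (\<forall>g \<in> strategies m. \<forall>X Y U. closed_loop m g X Y U \<longrightarrow>
       (\<forall>t \<le> horizon m.
          cond_density (prob_sp m) (shared_sp m t \<Otimes>\<^sub>M joint_private_sp m t) (state_sp m t)
            (\<lambda>\<omega>. (shared_data m t Y U \<omega>, private_data m t Y U \<omega>)) (X t) (\<Psi> t))) \<and>
    (\<forall>t \<le> horizon m. \<forall>\<delta> \<in> space (shared_sp m t). \<forall>l \<in> space (joint_private_sp m t).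
       prob_density (state_sp m t) (\<Psi> t (\<delta>, l))) \<and>
    information_state m \<Psi> \<and>
    (\<forall>t < horizon m. \<forall>y \<in> space (joint_obs_sp m). \<forall>u \<in> space (joint_dec_sp m t).
       \<forall>\<pi>. prob_density (state_sp m t) \<pi> \<longrightarrow>
         prob_density (state_sp m (Suc t)) (\<theta> t \<pi> y u) \<and>
         (\<forall>\<pi>'. prob_density (state_sp m t) \<pi>' \<longrightarrow> (AE x in state_sp m t. \<pi> x = \<pi>' x) \<longrightarrow>
            (AE x in state_sp m (Suc t). \<theta> t \<pi> y u x = \<theta> t \<pi>' y u x))) \<and>
    (\<forall>g \<in> strategies m. \<forall>X Y U. closed_loop m g X Y U \<longrightarrow>
       (\<forall>t < horizon m. \<forall>\<omega> \<in> space (prob_sp m).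
          \<Psi> (Suc t) (shared_data m (Suc t) Y U \<omega>, private_data m (Suc t) Y U \<omega>) =
          \<theta> t (\<Psi> t (shared_data m t Y U \<omega>, private_data m t Y U \<omega>)) (Y (Suc t) \<omega>) (U t \<omega>)))"
proof -
  obtain p0 where p0: "distributed (prob_sp m) (state_sp m 0) (init_rv m) p0"
    using assms unfolding team_model_def Let_def by blast
  have dyn_kernel: "\<forall>t < horizon m. has_density_kernel (prob_sp m) (state_sp m t \<Otimes>\<^sub>M joint_dec_sp m t)
      (state_sp m (Suc t)) (\<lambda>(x, u) \<omega>. dyn m t (x, u, noise_rv m t \<omega>))"
    and sens_kernel: "\<forall>t \<le> horizon m. \<forall>k \<in> members m. has_density_kernel (prob_sp m) (state_sp m t)
      (obs_sp m k) (\<lambda>x \<omega>. sens m t k (x, obs_noise_rv m t k \<omega>))"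
    using assms unfolding team_model_def Let_def by blast+
  \<comment> \<open>The condition on the time is kept under the existential quantifier, so that one
    total choice function covers all times.\<close>
  have "\<forall>t. \<exists>p. t < horizon m \<longrightarrow>
      (\<lambda>(a, x). p a x) \<in> borel_measurable ((state_sp m t \<Otimes>\<^sub>M joint_dec_sp m t) \<Otimes>\<^sub>M state_sp m (Suc t)) \<and>
      (\<forall>a\<in>space (state_sp m t \<Otimes>\<^sub>M joint_dec_sp m t). distributed (prob_sp m) (state_sp m (Suc t))
         ((\<lambda>(x, u) \<omega>. dyn m t (x, u, noise_rv m t \<omega>)) a) (p a))"
    using dyn_kernel unfolding has_density_kernel_def by blast
  from choice[OF this] obtain q where q: "\<forall>t. t < horizon m \<longrightarrow>
      (\<lambda>(a, x). q t a x) \<in> borel_measurable ((state_sp m t \<Otimes>\<^sub>M joint_dec_sp m t) \<Otimes>\<^sub>M state_sp m (Suc t)) \<and>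
      (\<forall>a\<in>space (state_sp m t \<Otimes>\<^sub>M joint_dec_sp m t). distributed (prob_sp m) (state_sp m (Suc t))
         ((\<lambda>(x, u) \<omega>. dyn m t (x, u, noise_rv m t \<omega>)) a) (q t a))"
    by blast
  have "\<forall>t k. \<exists>p. t \<le> horizon m \<longrightarrow> k \<in> members m \<longrightarrow>
      (\<lambda>(x, y). p x y) \<in> borel_measurable (state_sp m t \<Otimes>\<^sub>M obs_sp m k) \<and>
      (\<forall>x\<in>space (state_sp m t). distributed (prob_sp m) (obs_sp m k)
         (\<lambda>\<omega>. sens m t k (x, obs_noise_rv m t k \<omega>)) (p x))"
    using sens_kernel unfolding has_density_kernel_def by blast
  then obtain r where r: "\<And>t k. t \<le> horizon m \<Longrightarrow> k \<in> members m \<Longrightarrow>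
      (\<lambda>(x, y). r t k x y) \<in> borel_measurable (state_sp m t \<Otimes>\<^sub>M obs_sp m k) \<and>
      (\<forall>x\<in>space (state_sp m t). distributed (prob_sp m) (obs_sp m k)
         (\<lambda>\<omega>. sens m t k (x, obs_noise_rv m t k \<omega>)) (r t k x))"
    by metis
  \<comment> \<open>No strategy has been introduced at this point, so the witnesses
    \<open>info_state\<close> and \<open>filter_step\<close> are the same for all of them.\<close>
  interpret team_filter m p0 q r
  proof
    show "distributed (prob_sp m) (state_sp m (Suc t)) (\<lambda>\<omega>. dyn m t (x, u, noise_rv m t \<omega>)) (q t (x, u))"
      if "t < horizon m" "x \<in> space (state_sp m t)" "u \<in> space (joint_dec_sp m t)" for t x u
      using q[rule_format, OF that(1)] that(2,3) by (auto simp: space_pair_measure)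
  qed (use assms p0 q r in auto)
  have loop: "team_loop m p0 q r g X Y U" if "g \<in> strategies m" "closed_loop m g X Y U" for g X Y U
    using that by unfold_locales
  have "information_state m info_state"
    unfolding information_state_def using team_loop.info_state_step[OF loop]
    by (intro exI[of _ filter_step]) blast
  moreover have "AE x in Nx (Suc t). filter_step t \<pi> y u x = filter_step t \<pi>' y u x"
    if "AE x in Nx t. \<pi> x = \<pi>' x" for t \<pi> \<pi>' y u
    using filter_step_cong_AE[OF that] by simp
  ultimately show ?thesis
    using team_loop.cond_density_info_state[OF loop] team_loop.info_state_step[OF loop]
    by (intro exI[of _ info_state] exI[of _ filter_step])
      (auto simp: space_pair_measure intro!: prob_density_info_state prob_density_filter_step)
qed

end
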